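(* Consider the sparse Bernoulli hypergraph model and its Gaussian counterpart defined in the context. Assume that $\sup_{\alpha\in[n]^p}\|J_\alpha\|=O(1)$, that $\mathsf d_n\to\infty$ and $s_n-\mathsf d_n\to\infty$, and that the Bernoulli channel is well defined uniformly over $\Theta_n$. Then, for any prior $\pi$ on $T_n$, $$\sup_{\theta\in\Theta_n}\bigl|F_n(\theta)-F_n^{\mathrm G}(\theta)\bigr|\lesssim\delta_n,\qquad\delta_n=\frac1{\sqrt{\mathsf d_n}}+\frac1{\sqrt{s_n-\mathsf d_n}},$$ with implied constant independent of $n$.
   Context: Fix integers $p\ge2$, $d\ge1$ and reals $\lambda>0$, $\lambda_\star>0$. Let $\Theta_n=T_n=[-1,1]^{d\times n}$, with elements $u=(u_1,\dots,u_n)$, $u_i\in[-1,1]^d$; a prior $\pi$ is a Borel probability measure on $T_n$. For $\alpha=(\alpha_1,\dots,\alpha_p)\in[n]^p$ let $$\eta_\alpha(u)=n^{\frac{1-p}2}\,u_{\alpha_1}\otimes\cdots\otimes u_{\alpha_p}\in\mathbb R^{d^p},\qquad z_\alpha(u)=\langle J_\alpha,\eta_\alpha(u)\rangle,$$ where $J_\alpha\in\mathbb R^{d^p}$ are deterministic coupling vectors. Let $s_n=n^{p-1}$, $\mathsf d_n\in(0,s_n)$, and $b_n=\sqrt{(s_n-\mathsf d_n)/\mathsf d_n}$. Data ($P_\theta$): given $\theta\in\Theta_n$, $G=(G_\alpha)_{\alpha\in[n]^p}$ are independent with $$G_\alpha\sim\mathrm{Bernoulli}\Bigl(\tfrac{\mathsf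 d_n}{s_n}+\sqrt{\tfrac{\mathsf d_n}{s_n}\bigl(1-\tfrac{\mathsf d_n}{s_n}\bigr)}\sqrt{\lambda_\star}\,z_\alpha(\theta)\Bigr).$$ Likelihood process: $$X(t)=L_n(t,G)=\sum_{\alpha\in[n]^p}\Bigl[G_\alpha\log(1+b_n\sqrt\lambda\,z_\alpha(t))+(1-G_\alpha)\log\Bigl(1-\frac{\sqrt\lambda\,z_\alpha(t)}{b_n}\Bigr)\Bigr],\quad t\in T_n.$$ "The Bernoulli channel is well defined uniformly over $\Theta_n$" means that, for $\kappa\in\{\lambda,\lambda_\star\}$, every $n$, every $\alpha\in[n]^p$ and every $u\in\Theta_n$, $\ 1+b_n\sqrt\kappa\,z_\alpha(u)>0$ and $1-\sqrt\kappa\,z_\alpha(u)/b_n>0$ (i.e. the success probabilities, with signal-to-noise ratio $\lambda$ or $\lambda_\star$, lie in $(0,1)$). Gaussian counterpart ($Q_\theta$): $W_\alpha\sim N(\sqrt{\lambda_\star}z_\alpha(\theta),1)$ independently over $\alpha\in[n]^p$, and $$Y(t)=\sum_{\alpha\in[n]^p}\Bigl\{\sqrt\lambda\,W_\alpha z_\alpha(t)-\frac\lambda2z_\alpha(t)^2\Bigr\}.$$ Normalized free energies: $F_n(\theta)=\frac1n\mathbb E_{P_\theta}[\log\int_{T_n}e^{X(t)}\pi(\mathrm dt)]$, $F_n^{\mathrm G}(\theta)=\frac1n\mathbb E_{Q_\theta}[\log\int_{T_n}e^{Y(t)}\pi(\mathrm dt)]$. *)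

theory Defs
  imports "HOL-Probability.Probability" "HOL-Library.Landau_Symbols"
begin

text \<open>
  The order \<open>p\<close> and the dimension \<open>d\<close> are the cardinalities of the finite types \<open>'p\<close> and \<open>'d\<close>:
  \<open>'p\<close> indexes the \<open>p\<close> tensor slots, and \<open>real ^ ('p \<Rightarrow> 'd)\<close>, with its Euclidean inner product,
  is the space of dimension \<open>d ^ p\<close> that contains the tensors. The size \<open>n\<close> is a natural number.
\<close>

definition multi_indices :: "nat \<Rightarrow> ('p::finite \<Rightarrow> nat) set" where
  "multi_indices n = UNIV \<rightarrow>\<^sub>E {1..n}"

definition cube :: "(real ^ 'd::finite) set" where
  "cube = {x. \<forall>j. x $ j \<in> {-1..1}}"

definition params :: "nat \<Rightarrow> (nat \<Rightarrow> real ^ 'd::finite) set" where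
  "params n = {1..n} \<rightarrow>\<^sub>E cube"

text \<open>
  The factors are finitely many second countable spaces, so this product \<open>\<sigma>\<close>-algebra is the Borel
  \<open>\<sigma>\<close>-algebra of \<open>params n\<close>; the underlying space of a prior is \<open>params n\<close>.
\<close>

definition prior :: "nat \<Rightarrow> (nat \<Rightarrow> real ^ 'd::finite) measure \<Rightarrow> bool" where
  "prior n \<pi> \<longleftrightarrow>
     prob_space \<pi> \<and> sets \<pi> = sets (\<Pi>\<^sub>M i\<in>{1..n}. restrict_space borel cube)"

definition pure_tensor :: "('p::finite \<Rightarrow> real ^ 'd::finite) \<Rightarrow> real ^ ('p \<Rightarrow> 'd)" where
  "pure_tensor v = (\<chi> \<beta>. \<Prod>k\<in>UNIV. v k $ \<beta> k)"

definition eta :: "nat \<Rightarrow> ('p::finite \<Rightarrow> nat) \<Rightarrow> (nat \<Rightarrow> real ^ 'd::finite) \<Rightarrow> real ^ ('p \<Rightarrow> 'd)" where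
  "eta n \<alpha> u =
     real n powr ((1 - real CARD('p)) / 2) *\<^sub>R pure_tensor (\<lambda>k. u (\<alpha> k))"

text \<open>The couplings are allowed to change with \<open>n\<close>.\<close>

type_synonym ('p, 'd) couplings = "nat \<Rightarrow> ('p \<Rightarrow> nat) \<Rightarrow> real ^ ('p \<Rightarrow> 'd)"

definition zsig ::
  "('p::finite, 'd::finite) couplings \<Rightarrow> nat \<Rightarrow> ('p \<Rightarrow> nat) \<Rightarrow> (nat \<Rightarrow> real ^ 'd) \<Rightarrow> real" where
  "zsig J n \<alpha> u = J n \<alpha> \<bullet> eta n \<alpha> u"

text \<open>Below, \<open>D n\<close> is the degree parameter of the model of size \<open>n\<close>.\<close>

definition edge_scale :: "nat \<Rightarrow> nat \<Rightarrow> real" where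
  "edge_scale p n = real n ^ (p - 1)"

definition bcoef :: "nat \<Rightarrow> (nat \<Rightarrow> real) \<Rightarrow> nat \<Rightarrow> real" where
  "bcoef p D n = sqrt ((edge_scale p n - D n) / D n)"

definition channel_well_defined ::
  "('p::finite, 'd::finite) couplings \<Rightarrow> (nat \<Rightarrow> real) \<Rightarrow> real \<Rightarrow> bool" where
  "channel_well_defined J D \<kappa> \<longleftrightarrow>
     (\<forall>n\<ge>1. \<forall>\<alpha>\<in>multi_indices n. \<forall>u\<in>params n.
        1 + bcoef CARD('p) D n * sqrt \<kappa> * zsig J n \<alpha> u > 0 \<and>
        1 - sqrt \<kappa> * zsig J n \<alpha> u / bcoef CARD('p) D n > 0)"

text \<open>
  \<^const>\<open>bernoulli_pmf\<close> truncates its argument to the unit interval; under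
  \<^const>\<open>channel_well_defined\<close> the success probabilities already lie strictly inside it.
\<close>

definition success_prob ::
  "('p::finite, 'd::finite) couplings \<Rightarrow> (nat \<Rightarrow> real) \<Rightarrow> real \<Rightarrow> nat \<Rightarrow> (nat \<Rightarrow> real ^ 'd)
     \<Rightarrow> ('p \<Rightarrow> nat) \<Rightarrow> real" where
  "success_prob J D \<kappa> n \<theta> \<alpha> =
     (let q = D n / edge_scale CARD('p) n
      in q + sqrt (q * (1 - q)) * sqrt \<kappa> * zsig J n \<alpha> \<theta>)"

definition bernoulli_law ::
  "('p::finite, 'd::finite) couplings \<Rightarrow> (nat \<Rightarrow> real) \<Rightarrow> real \<Rightarrow> nat \<Rightarrow> (nat \<Rightarrow> real ^ 'd)
     \<Rightarrow> (('p \<Rightarrow> nat) \<Rightarrow> bool) measure" where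
  "bernoulli_law J D \<kappa> n \<theta> =
     (\<Pi>\<^sub>M \<alpha>\<in>multi_indices n. measure_pmf (bernoulli_pmf (success_prob J D \<kappa> n \<theta> \<alpha>)))"

definition bernoulli_loglik ::
  "('p::finite, 'd::finite) couplings \<Rightarrow> (nat \<Rightarrow> real) \<Rightarrow> real \<Rightarrow> nat
     \<Rightarrow> (('p \<Rightarrow> nat) \<Rightarrow> bool) \<Rightarrow> (nat \<Rightarrow> real ^ 'd) \<Rightarrow> real" where
  "bernoulli_loglik J D \<kappa> n G t =
     (\<Sum>\<alpha>\<in>multi_indices n.
        of_bool (G \<alpha>) * ln (1 + bcoef CARD('p) D n * sqrt \<kappa> * zsig J n \<alpha> t)
        + (1 - of_bool (G \<alpha>)) * ln (1 - sqrt \<kappa> * zsig J n \<alpha> t / bcoef CARD('p) D n))"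

definition gaussian_law ::
  "('p::finite, 'd::finite) couplings \<Rightarrow> real \<Rightarrow> nat \<Rightarrow> (nat \<Rightarrow> real ^ 'd)
     \<Rightarrow> (('p \<Rightarrow> nat) \<Rightarrow> real) measure" where
  "gaussian_law J \<kappa> n \<theta> =
     (\<Pi>\<^sub>M \<alpha>\<in>multi_indices n. density lborel (normal_density (sqrt \<kappa> * zsig J n \<alpha> \<theta>) 1))"

definition gaussian_loglik ::
  "('p::finite, 'd::finite) couplings \<Rightarrow> real \<Rightarrow> nat
     \<Rightarrow> (('p \<Rightarrow> nat) \<Rightarrow> real) \<Rightarrow> (nat \<Rightarrow> real ^ 'd) \<Rightarrow> real" where
  "gaussian_loglik J \<kappa> n W t =
     (\<Sum>\<alpha>\<in>multi_indices n. sqrt \<kappa> * W \<alpha> * zsig J n \<alpha> t - \<kappa> / 2 * (zsig J n \<alpha> t)\<^sup>2)"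

definition free_energy ::
  "nat \<Rightarrow> 'g measure \<Rightarrow> ('g \<Rightarrow> 't \<Rightarrow> real) \<Rightarrow> 't measure \<Rightarrow> real" where
  "free_energy n P H \<pi> = 1 / real n * (\<integral>g. ln (\<integral>t. exp (H g t) \<partial>\<pi>) \<partial>P)"

definition bernoulli_free_energy ::
  "('p::finite, 'd::finite) couplings \<Rightarrow> (nat \<Rightarrow> real) \<Rightarrow> real \<Rightarrow> real \<Rightarrow> nat
     \<Rightarrow> (nat \<Rightarrow> real ^ 'd) measure \<Rightarrow> (nat \<Rightarrow> real ^ 'd) \<Rightarrow> real" where
  "bernoulli_free_energy J D lam lam_star n \<pi> \<theta> =
     free_energy n (bernoulli_law J D lam_star n \<theta>) (bernoulli_loglik J D lam n) \<pi>"

definition gaussian_free_energy ::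
  "('p::finite, 'd::finite) couplings \<Rightarrow> real \<Rightarrow> real \<Rightarrow> nat
     \<Rightarrow> (nat \<Rightarrow> real ^ 'd) measure \<Rightarrow> (nat \<Rightarrow> real ^ 'd) \<Rightarrow> real" where
  "gaussian_free_energy J lam lam_star n \<pi> \<theta> =
     free_energy n (gaussian_law J lam_star n \<theta>) (gaussian_loglik J lam n) \<pi>"

definition error_rate :: "nat \<Rightarrow> (nat \<Rightarrow> real) \<Rightarrow> nat \<Rightarrow> real" where
  "error_rate p D n = 1 / sqrt (D n) + 1 / sqrt (edge_scale p n - D n)"

end

theory Submission
  imports Defs
begin

text \<open>
  The free energies are compared by Lindeberg's replacement of one hyperedge at a time
  (\<open>lindeberg_log_partition\<close>). With all other observations frozen, the rest of the likelihood turns the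
  prior into a Gibbs measure \<open>\<mu>\<close>, and it has to be shown that the expected log-partition function of a
  single observation, under an arbitrary probability measure \<open>\<mu>\<close>, is almost the same for a Bernoulli
  and for a Gaussian observation.

  Let \<open>a\<close> be the signal of the configuration at this hyperedge, scaled by \<open>sqrt lam\<close>, let \<open>m\<close> be its mean
  under \<open>\<mu>\<close>, and let \<open>y\<close> be the planted signal, scaled by \<open>sqrt lam_star\<close>. All of these are of order
  \<open>s powr (- 1 / 2)\<close>, where \<open>s = n ^ (p - 1)\<close>. Both expectations equal \<open>m * y - m\<^sup>2 / 2\<close> up to third order.
  For the Bernoulli channel the likelihood ratios are affine in \<open>a\<close>, so only \<open>m\<close> enters, and the
  normalisation by \<open>b\<close> makes the first two moments Gaussian (\<open>bernoulli_log_partition_expansion\<close>).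
  For the Gaussian channel the second moment of \<open>a\<close> is multiplied by a second Hermite polynomial, which
  has negligible mean (\<open>gaussian_channel_expansion\<close>).

  The third-order remainder of the Bernoulli channel is governed by the third absolute moment of a
  standardised Bernoulli variable with mean \<open>q = D / s\<close>, which is at most \<open>sqrt s * \<delta>\<close> for the error rate \<open>\<delta>\<close>
  (\<open>sparse_scaling\<close>). One replacement thus costs \<open>O(s powr (- 3 / 2) * sqrt s * \<delta>) = O(\<delta> / s)\<close>. There are
  \<open>n ^ p = n * s\<close> hyperedges, and division by \<open>n\<close> leaves \<open>O(\<delta>)\<close>.

  The constant must not depend on \<open>n\<close>. The logarithms are controlled by a lower bound \<open>\<kappa>\<close> on their
  arguments, which is uniform because the arguments tend to \<open>1\<close> as \<open>n\<close> grows and because the parameter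
  space is compact for each of the finitely many remaining sizes (\<open>channel_uniform_margin\<close>).
\<close>

section \<open>Log-partition functions of random Hamiltonians\<close>

definition log_partition :: "'t measure \<Rightarrow> ('t \<Rightarrow> real) \<Rightarrow> real" where
  "log_partition \<pi> f = ln (\<integral>t. exp (f t) \<partial>\<pi>)"

text \<open>
  The envelope bounds a random Hamiltonian uniformly over the configurations \<open>t\<close>, so it also bounds
  the log-partition function. Integrability of the envelope is what every use of Fubini below needs.
\<close>

definition has_envelope ::
  "'a measure \<Rightarrow> 't measure \<Rightarrow> ('a \<Rightarrow> 't \<Rightarrow> real) \<Rightarrow> ('a \<Rightarrow> real) \<Rightarrow> bool" where
  "has_envelope M \<pi> f F \<longleftrightarrow>
     case_prod f \<in> borel_measurable (M \<Otimes>\<^sub>M \<pi>) \<and> integrable M F \<and>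
     (\<forall>x\<in>space M. \<forall>t\<in>space \<pi>. \<bar>f x t\<bar> \<le> F x)"

lemma integrable_bounded_prob:
  fixes f :: "'t \<Rightarrow> real"
  assumes "prob_space \<pi>" "f \<in> borel_measurable \<pi>" "\<And>t. t \<in> space \<pi> \<Longrightarrow> \<bar>f t\<bar> \<le> c"
  shows "integrable \<pi> f"
proof -
  interpret prob_space \<pi> by fact
  show ?thesis
    by (rule integrable_const_bound[of _ c]) (use assms in auto)
qed

lemma integrable_exp_bounded:
  fixes f :: "'t \<Rightarrow> real"
  assumes "prob_space \<pi>" "f \<in> borel_measurable \<pi>" "\<And>t. t \<in> space \<pi> \<Longrightarrow> \<bar>f t\<bar> \<le> c"
  shows "integrable \<pi> (\<lambda>t. exp (f t))"
proof (rule integrable_bounded_prob[OF assms(1), of _ "exp c"])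
  show "\<bar>exp (f t)\<bar> \<le> exp c" if "t \<in> space \<pi>" for t
    using assms(3)[OF that] by simp
qed (use assms(2) in measurable)

lemma integral_exp_bounds:
  fixes f :: "'t \<Rightarrow> real"
  assumes "prob_space \<pi>" "f \<in> borel_measurable \<pi>" "\<And>t. t \<in> space \<pi> \<Longrightarrow> \<bar>f t\<bar> \<le> c"
  shows "exp (- c) \<le> (\<integral>t. exp (f t) \<partial>\<pi>)" "(\<integral>t. exp (f t) \<partial>\<pi>) \<le> exp c"
proof -
  interpret prob_space \<pi> by fact
  note int = integrable_exp_bounded[OF assms]
  have b: "- c \<le> f t" "f t \<le> c" if "t \<in> space \<pi>" for t
    using assms(3)[OF that] by auto
  show "exp (- c) \<le> (\<integral>t. exp (f t) \<partial>\<pi>)"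
    by (rule integral_ge_const[OF int]) (use b in auto)
  show "(\<integral>t. exp (f t) \<partial>\<pi>) \<le> exp c"
    by (rule integral_le_const[OF int]) (use b in auto)
qed

lemma log_partition_bound:
  assumes "prob_space \<pi>" "f \<in> borel_measurable \<pi>" "\<And>t. t \<in> space \<pi> \<Longrightarrow> \<bar>f t\<bar> \<le> c"
  shows "\<bar>log_partition \<pi> f\<bar> \<le> c"
proof -
  note b = integral_exp_bounds[OF assms]
  have pos: "0 < (\<integral>t. exp (f t) \<partial>\<pi>)"
    using b(1) by (meson exp_gt_zero less_le_trans)
  have "- c \<le> log_partition \<pi> f"
    unfolding log_partition_def using b(1) pos by (simp add: ln_ge_iff)
  moreover have "log_partition \<pi> f \<le> c"
    unfolding log_partition_def using b(2) pos by (metis exp_gt_zero ln_exp ln_le_cancel_iff)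
  ultimately show ?thesis by simp
qed

lemma envelope_measurable:
  assumes "has_envelope M \<pi> f F" "x \<in> space M"
  shows "f x \<in> borel_measurable \<pi>"
  using assms measurable_Pair2[of "case_prod f" M \<pi> borel x] by (auto simp: has_envelope_def)

lemma envelope_log_partition:
  assumes "prob_space \<pi>" and env: "has_envelope M \<pi> f F"
  shows "integrable M (\<lambda>x. log_partition \<pi> (f x))"
    and "\<And>x. x \<in> space M \<Longrightarrow> \<bar>log_partition \<pi> (f x)\<bar> \<le> F x"
proof -
  interpret prob_space \<pi> by fact
  show bound: "\<bar>log_partition \<pi> (f x)\<bar> \<le> F x" if "x \<in> space M" for x
    using env that
    by (intro log_partition_bound[OF assms(1) envelope_measurable[OF env that]])
      (auto simp: has_envelope_def)
  have [measurable]: "case_prod f \<in> borel_measurable (M \<Otimes>\<^sub>M \<pi>)" and F: "integrable M F"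
    using env by (auto simp: has_envelope_def)
  show "integrable M (\<lambda>x. log_partition \<pi> (f x))"
  proof (rule Bochner_Integration.integrable_bound[OF F])
    have "(\<lambda>x. \<integral>t. exp (case_prod f (x, t)) \<partial>\<pi>) \<in> borel_measurable M"
      by (rule borel_measurable_lebesgue_integral) measurable
    then show "(\<lambda>x. log_partition \<pi> (f x)) \<in> borel_measurable M"
      unfolding log_partition_def by simp
    show "AE x in M. norm (log_partition \<pi> (f x)) \<le> norm (F x)"
      using bound by (auto intro!: AE_I2 order_trans[OF bound])
  qed
qed

lemma envelope_add:
  assumes "has_envelope M \<pi> f F" "has_envelope M \<pi> g G"
  shows "has_envelope M \<pi> (\<lambda>x t. f x t + g x t) (\<lambda>x. F x + G x)"
  using assms unfolding has_envelope_def
  by (auto simp: case_prod_unfold intro!: abs_triangle_ineq[THEN order_trans] add_mono)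

lemma envelope_const:
  assumes "prob_space M" "c \<in> borel_measurable \<pi>" "\<And>t. t \<in> space \<pi> \<Longrightarrow> \<bar>c t\<bar> \<le> K"
  shows "has_envelope M \<pi> (\<lambda>x. c) (\<lambda>x. K)"
proof -
  interpret prob_space M by fact
  show ?thesis using assms unfolding has_envelope_def by auto
qed

lemma integrable_distr_prob:
  fixes F :: "'b \<Rightarrow> real"
  assumes "distr A B p = B" "p \<in> measurable A B" "integrable B F"
  shows "integrable A (\<lambda>x. F (p x))"
  using assms by (metis integrable_distr)

lemma envelope_pullback:
  assumes env: "has_envelope B \<pi> f F"
    and p[measurable]: "p \<in> measurable A B" and distr: "distr A B p = B"
  shows "has_envelope A \<pi> (\<lambda>x. f (p x)) (\<lambda>x. F (p x))"
proof -
  have [measurable]: "case_prod f \<in> borel_measurable (B \<Otimes>\<^sub>M \<pi>)" and F: "integrable B F"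
    and b: "\<And>x t. x \<in> space B \<Longrightarrow> t \<in> space \<pi> \<Longrightarrow> \<bar>f x t\<bar> \<le> F x"
    using env by (auto simp: has_envelope_def)
  have "(\<lambda>(x, t). case_prod f (p x, t)) \<in> borel_measurable (A \<Otimes>\<^sub>M \<pi>)"
    by measurable
  moreover have "integrable A (\<lambda>x. F (p x))"
    by (rule integrable_distr_prob[OF distr p F])
  ultimately show ?thesis
    using b measurable_space[OF p] by (auto simp: has_envelope_def)
qed

lemma distr_PiM_coordinate:
  assumes "\<And>i. prob_space (M i)" "i \<in> I"
  shows "distr (PiM I M) (M i) (\<lambda>x. x i) = M i"
proof -
  interpret product_prob_space M by (simp add: product_prob_spaceI assms(1))
  show ?thesis by (rule PiM_component[OF assms(2)])
qed

lemma envelope_sum: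
  assumes "finite J" "\<And>i. prob_space (M i)" "\<And>i. i \<in> J \<Longrightarrow> has_envelope (M i) \<pi> (h i) (H i)"
  shows "has_envelope (PiM J M) \<pi> (\<lambda>x t. \<Sum>i\<in>J. h i (x i) t) (\<lambda>x. \<Sum>i\<in>J. H i (x i))"
proof -
  have env: "has_envelope (PiM J M) \<pi> (\<lambda>x. h i (x i)) (\<lambda>x. H i (x i))" if "i \<in> J" for i
    by (rule envelope_pullback[OF assms(3)[OF that]])
      (use that distr_PiM_coordinate[OF assms(2) that] in auto)
  show ?thesis
    unfolding has_envelope_def
  proof (intro conjI ballI)
    have "(\<lambda>p. \<Sum>i\<in>J. case_prod (\<lambda>x. h i (x i)) p) \<in> borel_measurable (PiM J M \<Otimes>\<^sub>M \<pi>)"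
      by (rule borel_measurable_sum) (use env in \<open>auto simp: has_envelope_def\<close>)
    then show "(\<lambda>(x, t). \<Sum>i\<in>J. h i (x i) t) \<in> borel_measurable (PiM J M \<Otimes>\<^sub>M \<pi>)"
      by (simp add: case_prod_unfold)
    show "integrable (PiM J M) (\<lambda>x. \<Sum>i\<in>J. H i (x i))"
      by (rule Bochner_Integration.integrable_sum) (use env in \<open>auto simp: has_envelope_def\<close>)
    fix x t assume "x \<in> space (PiM J M)" "t \<in> space \<pi>"
    then show "\<bar>\<Sum>i\<in>J. h i (x i) t\<bar> \<le> (\<Sum>i\<in>J. H i (x i))"
      using env by (intro order_trans[OF sum_abs] sum_mono) (auto simp: has_envelope_def)
  qed
qed

text \<open>
  The Gibbs measure of the Hamiltonian \<open>S\<close> with reference measure \<open>\<pi>\<close>.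
\<close>

definition tilt :: "'t measure \<Rightarrow> ('t \<Rightarrow> real) \<Rightarrow> 't measure" where
  "tilt \<pi> S = density \<pi> (\<lambda>t. ennreal (exp (S t) / (\<integral>t. exp (S t) \<partial>\<pi>)))"

lemma sets_tilt: "sets (tilt \<pi> S) = sets \<pi>"
  by (simp add: tilt_def)

lemma
  assumes "prob_space \<pi>" and S[measurable]: "S \<in> borel_measurable \<pi>"
    and SC: "\<And>t. t \<in> space \<pi> \<Longrightarrow> \<bar>S t\<bar> \<le> C"
  shows prob_space_tilt: "prob_space (tilt \<pi> S)"
    and log_partition_tilt:
      "\<And>f K. f \<in> borel_measurable \<pi> \<Longrightarrow> (\<And>t. t \<in> space \<pi> \<Longrightarrow> \<bar>f t\<bar> \<le> K) \<Longrightarrow>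
        log_partition \<pi> (\<lambda>t. S t + f t) = log_partition \<pi> S + log_partition (tilt \<pi> S) f"
proof -
  interpret prob_space \<pi> by fact
  define Z where "Z = (\<integral>t. exp (S t) \<partial>\<pi>)"
  have Z: "Z > 0"
    using integral_exp_bounds(1)[OF assms] unfolding Z_def by (meson exp_gt_zero less_le_trans)
  have int: "integrable \<pi> (\<lambda>t. exp (S t))"
    by (rule integrable_exp_bounded[OF assms])
  have tilt: "tilt \<pi> S = density \<pi> (\<lambda>t. ennreal (exp (S t) / Z))"
    by (simp add: tilt_def Z_def)
  have "emeasure (tilt \<pi> S) (space (tilt \<pi> S)) = (\<integral>\<^sup>+t. ennreal (exp (S t) / Z) \<partial>\<pi>)"
    unfolding tilt by (subst emeasure_density) (auto intro!: nn_integral_cong)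
  also have "\<dots> = ennreal (\<integral>t. exp (S t) / Z \<partial>\<pi>)"
    using int Z by (intro nn_integral_eq_integral) auto
  also have "\<dots> = 1"
    using Z unfolding Z_def by simp
  finally show prob: "prob_space (tilt \<pi> S)"
    by (rule prob_spaceI)
  fix f :: "'a \<Rightarrow> real" and K
  assume f[measurable]: "f \<in> borel_measurable \<pi>" and K: "\<And>t. t \<in> space \<pi> \<Longrightarrow> \<bar>f t\<bar> \<le> K"
  have "f \<in> borel_measurable (tilt \<pi> S)" "\<And>t. t \<in> space (tilt \<pi> S) \<Longrightarrow> \<bar>f t\<bar> \<le> K"
    using K by (auto simp: tilt)
  then have pos: "(\<integral>t. exp (f t) \<partial>tilt \<pi> S) > 0"
    using integral_exp_bounds(1)[OF prob] by (meson exp_gt_zero less_le_trans)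
  have "(\<integral>t. exp (f t) \<partial>tilt \<pi> S) = (\<integral>t. (exp (S t) / Z) *\<^sub>R exp (f t) \<partial>\<pi>)"
    unfolding tilt using Z by (intro integral_density) auto
  also have "\<dots> = (\<integral>t. exp (S t + f t) / Z \<partial>\<pi>)"
    by (simp add: exp_add)
  finally have "(\<integral>t. exp (S t + f t) \<partial>\<pi>) = Z * (\<integral>t. exp (f t) \<partial>tilt \<pi> S)"
    using Z by simp
  then show "log_partition \<pi> (\<lambda>t. S t + f t) = log_partition \<pi> S + log_partition (tilt \<pi> S) f"
    unfolding log_partition_def using Z pos by (simp add: ln_mult Z_def)
qed

section \<open>Replacing the disorder one coordinate at a time\<close>

lemma integral_diff_bound:
  fixes f g :: "'a \<Rightarrow> real"
  assumes "prob_space M" "integrable M f" "integrable M g"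
    and "\<And>x. x \<in> space M \<Longrightarrow> \<bar>f x - g x\<bar> \<le> e"
  shows "\<bar>(\<integral>x. f x \<partial>M) - (\<integral>x. g x \<partial>M)\<bar> \<le> e"
proof -
  interpret prob_space M by fact
  have int: "integrable M (\<lambda>x. f x - g x)" using assms by simp
  have "(\<integral>x. f x - g x \<partial>M) \<le> e"
    by (rule integral_le_const[OF int]) (use assms(4) in \<open>force intro: AE_I2\<close>)
  moreover have "- e \<le> (\<integral>x. f x - g x \<partial>M)"
    by (rule integral_ge_const[OF int]) (use assms(4) in \<open>force intro: AE_I2\<close>)
  ultimately show ?thesis
    using assms by (simp add: Bochner_Integration.integral_diff)
qed

text \<open>
  Makes the log-partition function of a sum of two Hamiltonians with independent disorders
  integrable over the product of the disorders.
\<close>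

lemma envelope_pair:
  assumes "prob_space A" "prob_space B" and f: "has_envelope A \<pi> f F" and g: "has_envelope B \<pi> g G"
  shows "has_envelope (A \<Otimes>\<^sub>M B) \<pi> (\<lambda>p t. f (fst p) t + g (snd p) t) (\<lambda>p. F (fst p) + G (snd p))"
proof -
  interpret A: prob_space A by fact
  interpret B: prob_space B by fact
  interpret pair_prob_space A B ..
  have "distr (A \<Otimes>\<^sub>M B) A fst = A"
    by (simp add: B.distr_pair_fst)
  moreover have "distr (A \<Otimes>\<^sub>M B) B snd = B"
  proof -
    interpret BA: pair_prob_space B A ..
    have "distr (A \<Otimes>\<^sub>M B) B snd = distr (distr (B \<Otimes>\<^sub>M A) (A \<Otimes>\<^sub>M B) (\<lambda>(x, y). (y, x))) B snd"
      by (simp add: distr_pair_swap[symmetric])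
    also have "\<dots> = distr (B \<Otimes>\<^sub>M A) B fst"
      by (subst distr_distr) (auto simp: comp_def case_prod_unfold)
    finally show ?thesis by (simp add: A.distr_pair_fst)
  qed
  ultimately show ?thesis
    by (intro envelope_add envelope_pullback[OF f] envelope_pullback[OF g]) auto
qed

lemma log_partition_Fubini:
  assumes \<pi>: "prob_space \<pi>" and A: "prob_space A" and B: "prob_space B"
    and f: "has_envelope A \<pi> f F" and g: "has_envelope B \<pi> g G"
  defines "L \<equiv> \<lambda>x y. log_partition \<pi> (\<lambda>t. f x t + g y t)"
  shows "integrable A (\<lambda>x. \<integral>y. L x y \<partial>B)" and "integrable B (\<lambda>y. \<integral>x. L x y \<partial>A)"
    and "(\<integral>x. (\<integral>y. L x y \<partial>B) \<partial>A) = (\<integral>y. (\<integral>x. L x y \<partial>A) \<partial>B)"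
proof -
  interpret A: prob_space A by fact
  interpret B: prob_space B by fact
  interpret pair_prob_space A B ..
  have int: "integrable (A \<Otimes>\<^sub>M B) (case_prod L)"
    using envelope_log_partition(1)[OF \<pi> envelope_pair[OF A B f g]]
    unfolding L_def by (simp add: case_prod_unfold)
  show "integrable A (\<lambda>x. \<integral>y. L x y \<partial>B)" "integrable B (\<lambda>y. \<integral>x. L x y \<partial>A)"
    using integrable_fst[OF int] integrable_snd[OF int] by auto
  show "(\<integral>x. (\<integral>y. L x y \<partial>B) \<partial>A) = (\<integral>y. (\<integral>x. L x y \<partial>A) \<partial>B)"
    using Fubini_integral[OF int] by simp
qed

text \<open>
  Isolates the disorder of the coordinate \<open>i\<close>. The fixed part \<open>c\<close> collects the contribution of the
  coordinates that have already been split off.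
\<close>

lemma log_partition_PiM_insert:
  assumes \<pi>: "prob_space \<pi>" and J: "finite J" "i \<notin> J" and M: "\<And>i. prob_space (M i)"
    and env: "\<And>j. j \<in> insert i J \<Longrightarrow> has_envelope (M j) \<pi> (h j) (H j)"
    and c: "c \<in> borel_measurable \<pi>" "\<And>t. t \<in> space \<pi> \<Longrightarrow> \<bar>c t\<bar> \<le> K"
  shows "(\<integral>x. log_partition \<pi> (\<lambda>t. c t + (\<Sum>j\<in>insert i J. h j (x j) t)) \<partial>PiM (insert i J) M) =
      (\<integral>x. (\<integral>y. log_partition \<pi> (\<lambda>t. (c t + h i y t) + (\<Sum>j\<in>J. h j (x j) t)) \<partial>M i) \<partial>PiM J M)"
proof -
  interpret product_prob_space M by (simp add: product_prob_spaceI M)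
  have "prob_space (PiM (insert i J) M)" by (rule prob_space_PiM) (rule M)
  from envelope_add[OF envelope_const[OF this c] envelope_sum[OF _ M env]] J
  have "integrable (PiM (insert i J) M)
     (\<lambda>x. log_partition \<pi> (\<lambda>t. c t + (\<Sum>j\<in>insert i J. h j (x j) t)))"
    by (intro envelope_log_partition(1)[OF \<pi>]) auto
  note product_integral_insert[OF J this]
  also have "(\<integral>x. (\<integral>y. log_partition \<pi> (\<lambda>t. c t + (\<Sum>j\<in>insert i J. h j ((x(i:=y)) j) t)) \<partial>M i) \<partial>PiM J M)
     = (\<integral>x. (\<integral>y. log_partition \<pi> (\<lambda>t. (c t + h i y t) + (\<Sum>j\<in>J. h j (x j) t)) \<partial>M i) \<partial>PiM J M)"
  proof -
    have "(\<Sum>j\<in>insert i J. h j ((x(i:=y)) j) t) = h i y t + (\<Sum>j\<in>J. h j (x j) t)" for x y t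
      using J by (simp, intro sum.cong) auto
    then show ?thesis by (simp add: add.assoc del: fun_upd_apply)
  qed
  finally show ?thesis .
qed

text \<open>
  Factoring \<open>exp S\<close> out of the partition function leaves the log-partition function of one channel
  under the tilted prior, and there the hypothesis applies because it covers every prior.
\<close>

lemma one_channel_tilted:
  assumes \<pi>: "prob_space \<pi>" and h: "has_envelope M \<pi> h H" and k: "has_envelope N \<pi> k G"
    and M: "prob_space M" and N: "prob_space N"
    and step: "\<And>\<mu>. prob_space \<mu> \<Longrightarrow> sets \<mu> = sets \<pi> \<Longrightarrow>
      \<bar>(\<integral>x. log_partition \<mu> (h x) \<partial>M) - (\<integral>x. log_partition \<mu> (k x) \<partial>N)\<bar> \<le> e"
    and S: "S \<in> borel_measurable \<pi>" "\<And>t. t \<in> space \<pi> \<Longrightarrow> \<bar>S t\<bar> \<le> C"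
  shows "\<bar>(\<integral>x. log_partition \<pi> (\<lambda>t. S t + h x t) \<partial>M) - (\<integral>x. log_partition \<pi> (\<lambda>t. S t + k x t) \<partial>N)\<bar> \<le> e"
proof -
  let ?\<mu> = "tilt \<pi> S"
  have \<mu>: "prob_space ?\<mu>" "sets ?\<mu> = sets \<pi>"
    using prob_space_tilt[OF \<pi> S] by (auto simp: sets_tilt)
  have pull: "(\<integral>x. log_partition \<pi> (\<lambda>t. S t + f x t) \<partial>A)
      = log_partition \<pi> S + (\<integral>x. log_partition ?\<mu> (f x) \<partial>A)"
    if env: "has_envelope A \<pi> f F" and A: "prob_space A" for A :: "'x measure" and f F
  proof -
    interpret prob_space A by fact
    have "has_envelope A ?\<mu> f F"
      using env \<mu>(2) sets_eq_imp_space_eq[OF \<mu>(2)] unfolding has_envelope_def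
      by (metis measurable_cong_sets sets_pair_measure_cong)
    then have int: "integrable A (\<lambda>x. log_partition ?\<mu> (f x))"
      by (rule envelope_log_partition(1)[OF \<mu>(1)])
    have "(\<integral>x. log_partition \<pi> (\<lambda>t. S t + f x t) \<partial>A)
        = (\<integral>x. log_partition \<pi> S + log_partition ?\<mu> (f x) \<partial>A)"
      using env envelope_measurable[OF env]
      by (intro Bochner_Integration.integral_cong refl log_partition_tilt[OF \<pi> S, of "f _" "F _"])
        (auto simp: has_envelope_def)
    then show ?thesis using int by (simp add: prob_space)
  qed
  show ?thesis using step[OF \<mu>] pull[OF h M] pull[OF k N] by simp
qed

text \<open>
  Lindeberg's replacement, in a form that needs no hybrid product measures. The induction adds a fixed
  bounded part \<open>c\<close> to the Hamiltonian. For a new coordinate \<open>i\<close>, the disorder of \<open>i\<close> under \<open>M\<close> is frozen and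
  absorbed in \<open>c\<close>; the induction hypothesis then replaces \<open>M\<close> by \<open>N\<close> in the other coordinates. After an
  exchange of the integrals these other coordinates are frozen in turn, and the comparison of a single
  coordinate replaces \<open>M i\<close> by \<open>N i\<close>.
\<close>

lemma lindeberg_log_partition:
  assumes \<pi>: "prob_space \<pi>" and I: "finite I"
    and M: "\<And>i. prob_space (M i)" and N: "\<And>i. prob_space (N i)"
    and h: "\<And>i. i \<in> I \<Longrightarrow> has_envelope (M i) \<pi> (h i) (H i)"
    and k: "\<And>i. i \<in> I \<Longrightarrow> has_envelope (N i) \<pi> (k i) (G i)"
    and step: "\<And>i \<mu>. i \<in> I \<Longrightarrow> prob_space \<mu> \<Longrightarrow> sets \<mu> = sets \<pi> \<Longrightarrow>
      \<bar>(\<integral>x. log_partition \<mu> (h i x) \<partial>M i) - (\<integral>x. log_partition \<mu> (k i x) \<partial>N i)\<bar> \<le> e i"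
  shows "\<bar>(\<integral>x. log_partition \<pi> (\<lambda>t. \<Sum>i\<in>I. h i (x i) t) \<partial>PiM I M)
      - (\<integral>x. log_partition \<pi> (\<lambda>t. \<Sum>i\<in>I. k i (x i) t) \<partial>PiM I N)\<bar> \<le> (\<Sum>i\<in>I. e i)"
proof -
  have "\<bar>(\<integral>x. log_partition \<pi> (\<lambda>t. c t + (\<Sum>i\<in>I. h i (x i) t)) \<partial>PiM I M)
      - (\<integral>x. log_partition \<pi> (\<lambda>t. c t + (\<Sum>i\<in>I. k i (x i) t)) \<partial>PiM I N)\<bar> \<le> (\<Sum>i\<in>I. e i)"
    if "c \<in> borel_measurable \<pi>" "\<And>t. t \<in> space \<pi> \<Longrightarrow> \<bar>c t\<bar> \<le> K" for c K
    using I h k step that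
  proof (induction I arbitrary: c K rule: finite_induct)
    case empty
    interpret M: prob_space "PiM {} M" by (rule prob_space_PiM) (rule M)
    interpret N: prob_space "PiM {} N" by (rule prob_space_PiM) (rule N)
    show ?case using M.prob_space N.prob_space by simp
  next
    case (insert i J c K)
    note c = insert.prems(4,5)
    have PM: "prob_space (PiM J M)" and PN: "prob_space (PiM J N)"
      by (auto intro: prob_space_PiM M N)
    have hJ: "has_envelope (PiM J M) \<pi> (\<lambda>x t. \<Sum>j\<in>J. h j (x j) t) (\<lambda>x. \<Sum>j\<in>J. H j (x j))"
      by (intro envelope_sum insert M) auto
    have kJ: "has_envelope (PiM J N) \<pi> (\<lambda>x t. \<Sum>j\<in>J. k j (x j) t) (\<lambda>x. \<Sum>j\<in>J. G j (x j))"
      by (intro envelope_sum insert N) auto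
    have ch: "has_envelope (M i) \<pi> (\<lambda>y t. c t + h i y t) (\<lambda>y. K + H i y)"
      by (intro envelope_add envelope_const M insert c) auto
    have ck: "has_envelope (N i) \<pi> (\<lambda>y t. c t + k i y t) (\<lambda>y. K + G i y)"
      by (intro envelope_add envelope_const N insert c) auto
    note FM = log_partition_Fubini[OF \<pi> M PM ch hJ]
    note FX = log_partition_Fubini[OF \<pi> M PN ch kJ]
    note FN = log_partition_Fubini[OF \<pi> N PN ck kJ]
    \<comment> \<open>\<open>?U\<close> has all coordinates under \<open>M\<close>, \<open>?V\<close> only the coordinate \<open>i\<close>, \<open>?W\<close> none.\<close>
    let ?U = "\<integral>y. (\<integral>x. log_partition \<pi> (\<lambda>t. (c t + h i y t) + (\<Sum>j\<in>J. h j (x j) t)) \<partial>PiM J M) \<partial>M i"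
    let ?V = "\<integral>y. (\<integral>x. log_partition \<pi> (\<lambda>t. (c t + h i y t) + (\<Sum>j\<in>J. k j (x j) t)) \<partial>PiM J N) \<partial>M i"
    let ?W = "\<integral>x. (\<integral>y. log_partition \<pi> (\<lambda>t. (c t + k i y t) + (\<Sum>j\<in>J. k j (x j) t)) \<partial>N i) \<partial>PiM J N"
    have "\<bar>?U - ?V\<bar> \<le> (\<Sum>j\<in>J. e j)"
    proof (rule integral_diff_bound[OF M FM(1) FX(1)])
      fix y assume y: "y \<in> space (M i)"
      show "\<bar>(\<integral>x. log_partition \<pi> (\<lambda>t. (c t + h i y t) + (\<Sum>j\<in>J. h j (x j) t)) \<partial>PiM J M)
          - (\<integral>x. log_partition \<pi> (\<lambda>t. (c t + h i y t) + (\<Sum>j\<in>J. k j (x j) t)) \<partial>PiM J N)\<bar> \<le> (\<Sum>j\<in>J. e j)"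
      proof (rule insert.IH[where K="K + H i y"])
        show "(\<lambda>t. c t + h i y t) \<in> borel_measurable \<pi>"
          by (rule envelope_measurable[OF ch y])
        show "\<bar>c t + h i y t\<bar> \<le> K + H i y" if "t \<in> space \<pi>" for t
          using ch y that by (auto simp: has_envelope_def)
      qed (rule insert.prems; simp)+
    qed
    moreover have "\<bar>?V - ?W\<bar> \<le> e i"
      unfolding FX(3)
    proof (rule integral_diff_bound[OF PN FX(2) FN(2)])
      fix x assume x: "x \<in> space (PiM J N)"
      let ?S = "\<lambda>t. c t + (\<Sum>j\<in>J. k j (x j) t)"
      have "\<bar>?S t\<bar> \<le> K + (\<Sum>j\<in>J. G j (x j))" if "t \<in> space \<pi>" for t
        using c(2)[OF that] kJ x that unfolding has_envelope_def
        by (intro order_trans[OF abs_triangle_ineq] add_mono) auto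
      then have "\<bar>(\<integral>y. log_partition \<pi> (\<lambda>t. ?S t + h i y t) \<partial>M i)
          - (\<integral>y. log_partition \<pi> (\<lambda>t. ?S t + k i y t) \<partial>N i)\<bar> \<le> e i"
      proof (intro one_channel_tilted[OF \<pi> _ _ M N])
        show "has_envelope (M i) \<pi> (h i) (H i)" "has_envelope (N i) \<pi> (k i) (G i)"
          by (rule insert.prems; simp)+
        show "?S \<in> borel_measurable \<pi>"
          using c(1) envelope_measurable[OF kJ x] by (rule borel_measurable_add)
        show "\<bar>(\<integral>x. log_partition \<mu> (h i x) \<partial>M i) - (\<integral>x. log_partition \<mu> (k i x) \<partial>N i)\<bar> \<le> e i"
          if "prob_space \<mu>" "sets \<mu> = sets \<pi>" for \<mu>
          by (rule insert.prems(3)) (use that in auto)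
      qed auto
      then show "\<bar>(\<integral>y. log_partition \<pi> (\<lambda>t. (c t + h i y t) + (\<Sum>j\<in>J. k j (x j) t)) \<partial>M i)
          - (\<integral>y. log_partition \<pi> (\<lambda>t. (c t + k i y t) + (\<Sum>j\<in>J. k j (x j) t)) \<partial>N i)\<bar> \<le> e i"
        by (simp add: ac_simps)
    qed
    moreover have "(\<integral>x. log_partition \<pi> (\<lambda>t. c t + (\<Sum>j\<in>insert i J. h j (x j) t)) \<partial>PiM (insert i J) M) = ?U"
      unfolding FM(3) by (rule log_partition_PiM_insert[OF \<pi> insert.hyps M insert.prems(1) c])
    moreover have "(\<integral>x. log_partition \<pi> (\<lambda>t. c t + (\<Sum>j\<in>insert i J. k j (x j) t)) \<partial>PiM (insert i J) N) = ?W"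
      by (rule log_partition_PiM_insert[OF \<pi> insert.hyps N insert.prems(2) c])
    ultimately show ?case
      using insert.hyps by simp
  qed
  from this[of "\<lambda>_. 0" 0] show ?thesis by simp
qed

section \<open>One Gaussian observation\<close>

text \<open>
  The difference \<open>f r\<close> inside the absolute value has derivative \<open>r\<^sup>2 / (1 + r)\<close>, which lies between \<open>0\<close>
  and \<open>r\<^sup>2 / \<kappa>\<close>. Hence \<open>f\<close> and \<open>r ^ 3 / (3 * \<kappa>) - f r\<close> are both nondecreasing, and both vanish at \<open>0\<close>.
  The bound is global in \<open>r\<close>: large values and values near the singularity cost nothing more.
\<close>

lemma ln_third_order:
  fixes \<kappa> r :: real
  assumes \<kappa>: "0 < \<kappa>" "\<kappa> \<le> 1" and r: "\<kappa> \<le> 1 + r"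
  shows "\<bar>ln (1 + r) - r + r\<^sup>2 / 2\<bar> \<le> \<bar>r\<bar> ^ 3 / (3 * \<kappa>)"
proof -
  define f where "f = (\<lambda>x::real. ln (1 + x) - x + x\<^sup>2 / 2)"
  define g where "g = (\<lambda>x::real. x ^ 3 / (3 * \<kappa>) - f x)"
  have f': "(f has_real_derivative x\<^sup>2 / (1 + x)) (at x)"
    and g': "(g has_real_derivative x\<^sup>2 / \<kappa> - x\<^sup>2 / (1 + x)) (at x)" if "\<kappa> \<le> 1 + x" for x
  proof -
    have pos: "0 < 1 + x" using \<kappa> that by simp
    have eq: "1 / (1 + x) - 1 + x = x\<^sup>2 / (1 + x)"
      using pos by (simp add: field_simps power2_eq_square)
    show f': "(f has_real_derivative x\<^sup>2 / (1 + x)) (at x)"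
      unfolding f_def eq[symmetric] using pos by (auto intro!: derivative_eq_intros)
    show "(g has_real_derivative x\<^sup>2 / \<kappa> - x\<^sup>2 / (1 + x)) (at x)"
      unfolding g_def using \<kappa> by (auto intro!: derivative_eq_intros f')
  qed
  have mono: "f u \<le> f v" "g u \<le> g v" if "\<kappa> \<le> 1 + u" "u \<le> v" for u v
  proof -
    show "f u \<le> f v"
      using that \<kappa> by (intro DERIV_nonneg_imp_nondecreasing[of u v f])
        (auto intro!: exI f' divide_nonneg_nonneg)
    show "g u \<le> g v"
      using that \<kappa> by (intro DERIV_nonneg_imp_nondecreasing[of u v g])
        (auto intro!: exI[of _ "x\<^sup>2 / \<kappa> - x\<^sup>2 / (1 + x)" for x] g' divide_left_mono mult_pos_pos)
  qed
  have zero: "f 0 = 0" "g 0 = 0" by (auto simp: f_def g_def)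
  show ?thesis
  proof (cases "0 \<le> r")
    case True
    have "0 \<le> f r" "0 \<le> g r"
      using mono[of 0 r] True \<kappa> zero by auto
    then show ?thesis using True by (simp add: g_def f_def)
  next
    case False
    have "f r \<le> 0" "g r \<le> 0"
      using mono[of r 0] False r zero by auto
    then show ?thesis using False by (simp add: g_def f_def power3_eq_cube)
  qed
qed

lemma integral_abs_bound_prob:
  fixes f :: "'t \<Rightarrow> real"
  assumes "prob_space \<mu>" "f \<in> borel_measurable \<mu>" "\<And>t. t \<in> space \<mu> \<Longrightarrow> \<bar>f t\<bar> \<le> c"
  shows "\<bar>\<integral>t. f t \<partial>\<mu>\<bar> \<le> c"
proof -
  have "integrable \<mu> f" by (rule integrable_bounded_prob[OF assms])
  then show ?thesis
    using integral_diff_bound[OF assms(1), of f "\<lambda>_. 0" c] assms(3) by simp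
qed

text \<open>
  Grouping by powers of \<open>a\<close> rather than of the exponent gives the Hermite coefficients \<open>w\<close> and
  \<open>w\<^sup>2 - 1\<close>. The latter has mean zero under the standard normal law, which is why the second moment of \<open>a\<close>
  will drop out of the expected log-partition function at second order.
\<close>

lemma exp_gaussian_expansion:
  fixes w a \<epsilon> \<rho> :: real
  assumes a: "\<bar>a\<bar> \<le> \<epsilon>" and \<rho>: "\<epsilon> \<le> \<rho>" "\<bar>w\<bar> * \<epsilon> \<le> \<rho>" "\<bar>w * a - a\<^sup>2 / 2\<bar> \<le> \<rho>" "\<rho> \<le> 1"
  shows "\<bar>exp (w * a - a\<^sup>2 / 2) - (1 + w * a + (w\<^sup>2 - 1) * a\<^sup>2 / 2)\<bar> \<le> 2 * \<rho> ^ 3"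
proof -
  define H where "H = w * a - a\<^sup>2 / 2"
  have \<rho>0: "0 \<le> \<rho>" and H: "\<bar>H\<bar> \<le> \<rho>" using \<rho> a by (auto simp: H_def)
  obtain s where s: "\<bar>s\<bar> \<le> \<bar>H\<bar>" "exp H = (\<Sum>i<3. H ^ i / fact i) + exp s / fact 3 * H ^ 3"
    using Maclaurin_exp_le[of H 3] by blast
  have "exp s \<le> exp 1" using s H \<rho> by simp
  then have "exp s \<le> 3" using exp_le by linarith
  then have "exp s * \<bar>H\<bar> ^ 3 \<le> 3 * \<bar>H\<bar> ^ 3" by (intro mult_right_mono) auto
  then have "\<bar>exp H - (\<Sum>i<3. H ^ i / fact i)\<bar> \<le> 1 / 2 * \<bar>H\<bar> ^ 3"
    unfolding s(2) by (simp add: abs_mult power_abs fact_numeral)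
  moreover have "\<bar>H\<bar> ^ 3 \<le> \<rho> ^ 3" using H by (intro power_mono) auto
  moreover have "(\<Sum>i<3. H ^ i / fact i) = 1 + H + H\<^sup>2 / 2"
    by (simp add: numeral_3_eq_3 power2_eq_square)
  moreover have "1 + H + H\<^sup>2 / 2 = (1 + w * a + (w\<^sup>2 - 1) * a\<^sup>2 / 2) - w * a ^ 3 / 2 + a ^ 4 / 8"
    unfolding H_def by (simp add: power2_eq_square power3_eq_cube power4_eq_xxxx algebra_simps diff_divide_distrib add_divide_distrib)
  moreover have "\<bar>w * a ^ 3\<bar> \<le> \<rho> ^ 3"
  proof -
    have "\<bar>w * a ^ 3\<bar> = (\<bar>w\<bar> * \<bar>a\<bar>) * (\<bar>a\<bar> * \<bar>a\<bar>)"
      by (simp add: abs_mult power3_eq_cube)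
    also have "\<dots> \<le> \<rho> * (\<rho> * \<rho>)"
    proof (intro mult_mono)
      have "\<bar>w\<bar> * \<bar>a\<bar> \<le> \<bar>w\<bar> * \<epsilon>" using a by (intro mult_left_mono) auto
      then show "\<bar>w\<bar> * \<bar>a\<bar> \<le> \<rho>" using \<rho> by simp
    qed (use a \<rho> \<rho>0 in auto)
    finally show ?thesis by (simp add: power3_eq_cube)
  qed
  moreover have "\<bar>a ^ 4\<bar> \<le> \<rho> ^ 3"
  proof -
    have "\<bar>a ^ 4\<bar> = \<bar>a\<bar> ^ 4" by (simp add: power_abs)
    also have "\<dots> \<le> \<rho> ^ 4" using a \<rho> by (intro power_mono) auto
    also have "\<dots> \<le> \<rho> ^ 3" using \<rho> \<rho>0 by (intro power_decreasing) auto
    finally show ?thesis .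
  qed
  moreover have "0 \<le> \<rho> ^ 3" using \<rho>0 by simp
  ultimately show ?thesis unfolding H_def[symmetric] by linarith
qed

lemma ln_second_order_expansion:
  fixes \<rho> A B Z :: real
  assumes \<rho>: "0 \<le> \<rho>" "\<rho> \<le> 1" and A: "\<bar>A\<bar> \<le> \<rho>" and B: "\<bar>B\<bar> \<le> \<rho>\<^sup>2 / 2"
    and Z: "\<bar>Z - (1 + A + B)\<bar> \<le> 2 * \<rho> ^ 3" "1 / 3 \<le> Z"
  shows "\<bar>ln Z - (A + B - A\<^sup>2 / 2)\<bar> \<le> 52 * \<rho> ^ 3"
proof -
  define r where "r = Z - 1"
  have \<rho>2: "\<rho>\<^sup>2 \<le> \<rho>" and \<rho>3: "\<rho> ^ 3 \<le> \<rho>\<^sup>2"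
    using \<rho> power_decreasing[of 1 2 \<rho>] power_decreasing[of 2 3 \<rho>] by auto
  have r: "\<bar>r - (A + B)\<bar> \<le> 2 * \<rho> ^ 3" using Z by (simp add: r_def)
  have rA: "\<bar>r - A\<bar> \<le> 5 / 2 * \<rho>\<^sup>2" using r B \<rho>3 by linarith
  have r_le: "\<bar>r\<bar> \<le> 7 / 2 * \<rho>" using rA A \<rho>2 by linarith
  have "\<bar>ln (1 + r) - r + r\<^sup>2 / 2\<bar> \<le> \<bar>r\<bar> ^ 3 / (3 * (1 / 3))"
    by (rule ln_third_order) (use Z in \<open>auto simp: r_def\<close>)
  also have "\<dots> \<le> (7 / 2 * \<rho>) ^ 3"
    using r_le by (simp add: power_mono)
  finally have 1: "\<bar>ln Z - r + r\<^sup>2 / 2\<bar> \<le> 343 / 8 * \<rho> ^ 3"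
    by (simp add: r_def power_mult_distrib power_divide)
  have "\<bar>r\<^sup>2 - A\<^sup>2\<bar> = \<bar>r - A\<bar> * \<bar>r + A\<bar>"
    by (simp add: abs_mult[symmetric] power2_eq_square algebra_simps)
  also have "\<dots> \<le> (5 / 2 * \<rho>\<^sup>2) * (9 / 2 * \<rho>)"
  proof (intro mult_mono rA)
    show "\<bar>r + A\<bar> \<le> 9 / 2 * \<rho>" using r_le A by linarith
  qed auto
  also have "\<dots> = 45 / 4 * \<rho> ^ 3"
    by (simp add: power2_eq_square power3_eq_cube)
  finally have 2: "\<bar>r\<^sup>2 - A\<^sup>2\<bar> \<le> 45 / 4 * \<rho> ^ 3" .
  have "0 \<le> \<rho> ^ 3" using \<rho> by simp
  with 1 2 r show ?thesis by linarith
qed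

text \<open>
  The quantity \<open>\<epsilon> * (E + \<bar>w\<bar>)\<close> dominates the exponent. When it is at most \<open>1\<close>, the Taylor expansions of
  \<open>exp\<close> and \<open>ln\<close> apply. When it exceeds \<open>1\<close>, each term on the left is at most its first or second power,
  hence at most its cube. The estimate therefore holds for every \<open>w\<close> and can be integrated.
\<close>

lemma gaussian_log_partition_expansion:
  fixes a :: "'t \<Rightarrow> real" and w \<epsilon> E :: real
  assumes \<mu>: "prob_space \<mu>" and a_meas[measurable]: "a \<in> borel_measurable \<mu>"
    and a: "\<And>t. t \<in> space \<mu> \<Longrightarrow> \<bar>a t\<bar> \<le> \<epsilon>" and \<epsilon>: "0 \<le> \<epsilon>" "\<epsilon> \<le> E" "1 \<le> E"
  defines "m \<equiv> \<integral>t. a t \<partial>\<mu>" and "v \<equiv> \<integral>t. (a t)\<^sup>2 \<partial>\<mu>"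
  shows "\<bar>log_partition \<mu> (\<lambda>t. w * a t - (a t)\<^sup>2 / 2) - (w * m + (w\<^sup>2 - 1) * v / 2 - (w * m)\<^sup>2 / 2)\<bar>
      \<le> 52 * (\<epsilon> * (E + \<bar>w\<bar>)) ^ 3"
proof -
  interpret prob_space \<mu> by fact
  define \<rho> where "\<rho> = \<epsilon> * (E + \<bar>w\<bar>)"
  have \<epsilon>\<rho>: "\<epsilon> \<le> \<rho>"
    using mult_left_mono[of 1 "E + \<bar>w\<bar>" \<epsilon>] \<epsilon> by (simp add: \<rho>_def)
  have w\<rho>: "\<bar>w\<bar> * \<epsilon> \<le> \<rho>"
    using \<epsilon> by (simp add: \<rho>_def algebra_simps)
  have \<rho>0: "0 \<le> \<rho>" using \<epsilon> \<epsilon>\<rho> by linarith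
  have a2: "(a t)\<^sup>2 \<le> \<epsilon>\<^sup>2" if "t \<in> space \<mu>" for t
    using a[OF that] by (metis abs_ge_zero power2_abs power_mono)
  have H: "\<bar>w * a t - (a t)\<^sup>2 / 2\<bar> \<le> \<rho>" if t: "t \<in> space \<mu>" for t
  proof -
    have "\<bar>w * a t\<bar> \<le> \<bar>w\<bar> * \<epsilon>"
      using a[OF t] by (simp add: abs_mult mult_left_mono)
    moreover have "\<epsilon>\<^sup>2 \<le> \<epsilon> * E" using \<epsilon> by (simp add: power2_eq_square mult_left_mono)
    ultimately show ?thesis
      using a2[OF t] zero_le_power2[of "a t"] zero_le_power2[of \<epsilon>]
      unfolding \<rho>_def distrib_left mult.commute[of \<epsilon> "\<bar>w\<bar>"] by linarith
  qed
  have int_a: "integrable \<mu> a"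
    by (rule integrable_bounded_prob[OF \<mu> _ a]) auto
  have int_a2: "integrable \<mu> (\<lambda>t. (a t)\<^sup>2)"
    by (rule integrable_bounded_prob[OF \<mu>, of _ "\<epsilon>\<^sup>2"]) (use a2 in auto)
  have m: "\<bar>w * m\<bar> \<le> \<rho>"
  proof -
    have "\<bar>m\<bar> \<le> \<epsilon>" unfolding m_def by (rule integral_abs_bound_prob[OF \<mu> _ a]) auto
    then have "\<bar>w * m\<bar> \<le> \<bar>w\<bar> * \<epsilon>" by (simp add: abs_mult mult_left_mono)
    then show ?thesis using w\<rho> by simp
  qed
  have v: "\<bar>(w\<^sup>2 - 1) * v / 2\<bar> \<le> \<rho>\<^sup>2 / 2"
  proof -
    have v0: "0 \<le> v" unfolding v_def by simp
    have v: "v \<le> \<epsilon>\<^sup>2" unfolding v_def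
      using integral_abs_bound_prob[OF \<mu>, of "\<lambda>t. (a t)\<^sup>2" "\<epsilon>\<^sup>2"] a2 by auto
    have "w\<^sup>2 * v \<le> w\<^sup>2 * \<epsilon>\<^sup>2" using v by (simp add: mult_left_mono)
    also have "\<dots> = (\<bar>w\<bar> * \<epsilon>)\<^sup>2" by (simp add: power_mult_distrib)
    also have "\<dots> \<le> \<rho>\<^sup>2" using w\<rho> \<epsilon> by (intro power_mono) auto
    finally have "w\<^sup>2 * v \<le> \<rho>\<^sup>2" .
    moreover have "v \<le> \<rho>\<^sup>2" using v power_mono[OF \<epsilon>\<rho> \<epsilon>(1), of 2] by simp
    moreover have "0 \<le> w\<^sup>2 * v" using v0 by simp
    ultimately have "w\<^sup>2 * v - v \<le> \<rho>\<^sup>2" "v - w\<^sup>2 * v \<le> \<rho>\<^sup>2" using v0 by linarith+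
    then show ?thesis by (simp add: left_diff_distrib abs_le_iff)
  qed
  show ?thesis unfolding \<rho>_def[symmetric]
  proof (cases "\<rho> \<le> 1")
    case True
    let ?Z = "\<integral>t. exp (w * a t - (a t)\<^sup>2 / 2) \<partial>\<mu>"
    have "\<bar>?Z - (\<integral>t. 1 + w * a t + (w\<^sup>2 - 1) * (a t)\<^sup>2 / 2 \<partial>\<mu>)\<bar> \<le> 2 * \<rho> ^ 3"
      using exp_gaussian_expansion[OF a \<epsilon>\<rho> w\<rho> H True] int_a int_a2
      by (intro integral_diff_bound[OF \<mu>] integrable_exp_bounded[OF \<mu> _ H]) auto
    also have "(\<integral>t. 1 + w * a t + (w\<^sup>2 - 1) * (a t)\<^sup>2 / 2 \<partial>\<mu>) = 1 + w * m + (w\<^sup>2 - 1) * v / 2"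
      using int_a int_a2 by (simp add: m_def v_def prob_space)
    finally have Z: "\<bar>?Z - (1 + w * m + (w\<^sup>2 - 1) * v / 2)\<bar> \<le> 2 * \<rho> ^ 3" .
    have "1 / 3 \<le> exp (- 1 :: real)"
      using exp_le by (simp add: exp_minus field_simps)
    also have "\<dots> \<le> exp (- \<rho>)" using True by simp
    also have "\<dots> \<le> ?Z" by (rule integral_exp_bounds[OF \<mu> _ H]) auto
    finally show "\<bar>log_partition \<mu> (\<lambda>t. w * a t - (a t)\<^sup>2 / 2)
        - (w * m + (w\<^sup>2 - 1) * v / 2 - (w * m)\<^sup>2 / 2)\<bar> \<le> 52 * \<rho> ^ 3"
      unfolding log_partition_def
      using ln_second_order_expansion[OF \<rho>0 True m v Z] by simp
  next
    case False
    have "\<bar>log_partition \<mu> (\<lambda>t. w * a t - (a t)\<^sup>2 / 2)\<bar> \<le> \<rho>"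
      by (rule log_partition_bound[OF \<mu> _ H]) auto
    moreover have "(w * m)\<^sup>2 \<le> \<rho>\<^sup>2" using m by (metis abs_ge_zero power2_abs power_mono)
    moreover have "\<rho> \<le> \<rho> ^ 3" "\<rho>\<^sup>2 \<le> \<rho> ^ 3"
      using False power_increasing[of 1 3 \<rho>] power_increasing[of 2 3 \<rho>] by auto
    moreover have "0 \<le> (w * m)\<^sup>2" by simp
    ultimately show "\<bar>log_partition \<mu> (\<lambda>t. w * a t - (a t)\<^sup>2 / 2)
        - (w * m + (w\<^sup>2 - 1) * v / 2 - (w * m)\<^sup>2 / 2)\<bar> \<le> 52 * \<rho> ^ 3"
      using m v \<rho>0 by linarith
  qed
qed

lemma
  fixes y :: real
  shows integrable_normal_power:
      "integrable (density lborel (normal_density y 1)) (\<lambda>x. (x - y) ^ k)"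
    and normal_moment_1: "(\<integral>x. (x - y) \<partial>density lborel (normal_density y 1)) = 0"
    and normal_moment_2: "(\<integral>x. (x - y)\<^sup>2 \<partial>density lborel (normal_density y 1)) = 1"
    and normal_moment_4: "(\<integral>x. (x - y) ^ 4 \<partial>density lborel (normal_density y 1)) = 3"
proof -
  show "integrable (density lborel (normal_density y 1)) (\<lambda>x. (x - y) ^ k)"
    using integrable_normal_moment[of 1 y k] by (simp add: integrable_density)
  show "(\<integral>x. (x - y) \<partial>density lborel (normal_density y 1)) = 0"
    using integral_normal_moment_odd[of 1 y 0] by (simp add: integral_density)
  show "(\<integral>x. (x - y)\<^sup>2 \<partial>density lborel (normal_density y 1)) = 1"
    using integral_normal_moment_even[of 1 y 1] by (simp add: integral_density)
  show "(\<integral>x. (x - y) ^ 4 \<partial>density lborel (normal_density y 1)) = 3"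
    using integral_normal_moment_even[of 1 y 2] by (simp add: integral_density fact_numeral)
qed

lemma integrable_normal_monomials:
  fixes y :: real
  shows "integrable (density lborel (normal_density y 1)) (\<lambda>x. x)"
    and "integrable (density lborel (normal_density y 1)) (\<lambda>x. x\<^sup>2)"
    and "(\<integral>x. x \<partial>density lborel (normal_density y 1)) = y"
    and "(\<integral>x. x\<^sup>2 \<partial>density lborel (normal_density y 1)) = 1 + y\<^sup>2"
proof -
  interpret prob_space "density lborel (normal_density y 1)"
    by (rule prob_space_normal_density) simp
  note i1 = integrable_normal_power[of y 1, simplified] and i2 = integrable_normal_power[of y 2]
  have x: "x = (x - y) + y" and x2: "x\<^sup>2 = (x - y)\<^sup>2 + 2 * y * (x - y) + y\<^sup>2" for x
    by (auto simp: power2_eq_square algebra_simps)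
  show "integrable (density lborel (normal_density y 1)) (\<lambda>x. x)"
    by (subst x) (intro Bochner_Integration.integrable_add i1, simp)
  show "integrable (density lborel (normal_density y 1)) (\<lambda>x. x\<^sup>2)"
    by (subst x2) (intro Bochner_Integration.integrable_add i2 integrable_mult_right i1, simp)
  have "(\<integral>x. x \<partial>density lborel (normal_density y 1)) = (\<integral>x. (x - y) + y \<partial>density lborel (normal_density y 1))"
    by simp
  also have "\<dots> = y"
    by (subst Bochner_Integration.integral_add[OF i1])
      (use prob_space normal_moment_1[of y] in \<open>simp_all del: Bochner_Integration.integral_diff\<close>)
  finally show "(\<integral>x. x \<partial>density lborel (normal_density y 1)) = y" .
  have "(\<integral>x. x\<^sup>2 \<partial>density lborel (normal_density y 1))
      = (\<integral>x. (x - y)\<^sup>2 + (2 * y * (x - y) + y\<^sup>2) \<partial>density lborel (normal_density y 1))"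
    by (subst x2) (simp add: add.assoc)
  also have "\<dots> = (\<integral>x. (x - y)\<^sup>2 \<partial>density lborel (normal_density y 1))
      + ((\<integral>x. 2 * y * (x - y) \<partial>density lborel (normal_density y 1)) + y\<^sup>2)"
    using i1 i2 prob_space by (subst Bochner_Integration.integral_add)
      (auto simp del: Bochner_Integration.integral_diff intro!: integrable_mult_right)
  also have "\<dots> = 1 + y\<^sup>2"
    using normal_moment_1[of y] normal_moment_2[of y]
    by (simp del: Bochner_Integration.integral_diff)
  finally show "(\<integral>x. x\<^sup>2 \<partial>density lborel (normal_density y 1)) = 1 + y\<^sup>2" .
qed

text \<open>
  Reduces the third absolute moment to the fourth central moment of the normal law.
\<close>

lemma cubic_le_quartic:
  fixes E w y :: real
  assumes "1 \<le> E" "\<bar>y\<bar> \<le> E"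
  shows "(E + \<bar>w\<bar>) ^ 3 \<le> 8 * (16 * E ^ 4 + (w - y) ^ 4)"
proof -
  have four: "(s + u) ^ 4 \<le> 8 * (s ^ 4 + u ^ 4)" for s u :: real
  proof -
    have sq: "(x + z)\<^sup>2 \<le> 2 * (x\<^sup>2 + z\<^sup>2)" for x z :: real
      using zero_le_power2[of "x - z"] by (simp add: power2_eq_square algebra_simps)
    have "(s + u) ^ 4 = ((s + u)\<^sup>2)\<^sup>2" by simp
    also have "\<dots> \<le> (2 * (s\<^sup>2 + u\<^sup>2))\<^sup>2" by (intro power_mono sq) simp
    also have "\<dots> = 4 * (s\<^sup>2 + u\<^sup>2)\<^sup>2" by (subst power_mult_distrib) simp
    also have "\<dots> \<le> 4 * (2 * ((s\<^sup>2)\<^sup>2 + (u\<^sup>2)\<^sup>2))" by (intro mult_left_mono sq) simp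
    finally show ?thesis by simp
  qed
  have "(E + \<bar>w\<bar>) ^ 3 \<le> (E + \<bar>w\<bar>) ^ 4"
    using assms by (intro power_increasing) auto
  also have "\<dots> \<le> (2 * E + \<bar>w - y\<bar>) ^ 4"
    using assms by (intro power_mono) auto
  also have "\<dots> \<le> 8 * ((2 * E) ^ 4 + \<bar>w - y\<bar> ^ 4)"
    by (rule four)
  finally show ?thesis by (simp add: power_mult_distrib)
qed

lemma gaussian_envelope:
  assumes "prob_space \<pi>" and [measurable]: "a \<in> borel_measurable \<pi>"
    and a: "\<And>t. t \<in> space \<pi> \<Longrightarrow> \<bar>a t\<bar> \<le> \<epsilon>"
  shows "has_envelope (density lborel (normal_density y 1)) \<pi>
    (\<lambda>w t. w * a t - (a t)\<^sup>2 / 2) (\<lambda>w. \<epsilon> * \<bar>w\<bar> + \<epsilon>\<^sup>2 / 2)"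
  unfolding has_envelope_def
proof (intro conjI ballI)
  interpret prob_space "density lborel (normal_density y 1)"
    by (rule prob_space_normal_density) simp
  show "(\<lambda>(w, t). w * a t - (a t)\<^sup>2 / 2) \<in> borel_measurable (density lborel (normal_density y 1) \<Otimes>\<^sub>M \<pi>)"
    by measurable
  show "integrable (density lborel (normal_density y 1)) (\<lambda>w. \<epsilon> * \<bar>w\<bar> + \<epsilon>\<^sup>2 / 2)"
    by (intro Bochner_Integration.integrable_add integrable_mult_right integrable_abs
        integrable_normal_monomials) simp
  fix w t assume t: "t \<in> space \<pi>"
  have "\<bar>w * a t\<bar> \<le> \<epsilon> * \<bar>w\<bar>"
    using a[OF t] by (simp add: abs_mult mult.commute[of "\<bar>w\<bar>"] mult_right_mono)
  moreover have "(a t)\<^sup>2 \<le> \<epsilon>\<^sup>2"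
    using a[OF t] by (metis abs_ge_zero power2_abs power_mono)
  ultimately show "\<bar>w * a t - (a t)\<^sup>2 / 2\<bar> \<le> \<epsilon> * \<bar>w\<bar> + \<epsilon>\<^sup>2 / 2"
    using zero_le_power2[of "a t"] by linarith
qed

text \<open>
  Taking the expectation of the expansion over \<open>w\<close>, with \<open>v\<close> the second moment of \<open>a\<close>, leaves
  \<open>m * y - m\<^sup>2 / 2 + y\<^sup>2 * (v - m\<^sup>2) / 2\<close>. The last term is of fourth order because \<open>y\<close> and \<open>a\<close> are both at
  most \<open>\<epsilon>\<close>.
\<close>

lemma gaussian_channel_expansion:
  fixes a :: "'t \<Rightarrow> real" and y \<epsilon> E :: real
  assumes \<mu>: "prob_space \<mu>" and a_meas[measurable]: "a \<in> borel_measurable \<mu>"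
    and a: "\<And>t. t \<in> space \<mu> \<Longrightarrow> \<bar>a t\<bar> \<le> \<epsilon>" and \<epsilon>: "0 \<le> \<epsilon>" "\<epsilon> \<le> E" "1 \<le> E" and y: "\<bar>y\<bar> \<le> \<epsilon>"
  defines "m \<equiv> \<integral>t. a t \<partial>\<mu>"
  shows "\<bar>(\<integral>w. log_partition \<mu> (\<lambda>t. w * a t - (a t)\<^sup>2 / 2) \<partial>density lborel (normal_density y 1))
      - (m * y - m\<^sup>2 / 2)\<bar> \<le> 8000 * E ^ 4 * \<epsilon> ^ 3"
proof -
  let ?N = "density lborel (normal_density y 1)"
  interpret N: prob_space ?N by (rule prob_space_normal_density) simp
  interpret prob_space \<mu> by fact
  define v where "v = (\<integral>t. (a t)\<^sup>2 \<partial>\<mu>)"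
  let ?L = "\<lambda>w. log_partition \<mu> (\<lambda>t. w * a t - (a t)\<^sup>2 / 2)"
  let ?T = "\<lambda>w. w * m + (w\<^sup>2 - 1) * v / 2 - (w * m)\<^sup>2 / 2"
  let ?Q = "\<lambda>w. 52 * \<epsilon> ^ 3 * (8 * (16 * E ^ 4 + (w - y) ^ 4))"
  note mono = integrable_normal_monomials[of y]
  \<comment> \<open>A quadratic polynomial in \<open>w\<close>, so that the first two moments of the normal law suffice.\<close>
  have T_eq: "?T = (\<lambda>w. m * w + (v - m\<^sup>2) / 2 * w\<^sup>2 - v / 2)"
    by (auto simp: fun_eq_iff power2_eq_square field_simps)
  have int_L: "integrable ?N ?L"
    by (rule envelope_log_partition(1)[OF \<mu> gaussian_envelope[OF \<mu> a_meas a]])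
  have int_T: "integrable ?N ?T"
    unfolding T_eq using mono by simp
  have int_Q: "integrable ?N ?Q"
    using integrable_normal_power[of y 4] by simp
  have "\<bar>?L w - ?T w\<bar> \<le> ?Q w" for w
  proof -
    have "\<bar>?L w - ?T w\<bar> \<le> 52 * (\<epsilon> * (E + \<bar>w\<bar>)) ^ 3"
      using gaussian_log_partition_expansion[OF \<mu> a_meas a \<epsilon>] by (simp add: m_def v_def)
    also have "\<dots> = 52 * \<epsilon> ^ 3 * (E + \<bar>w\<bar>) ^ 3" by (simp add: power_mult_distrib)
    also have "\<dots> \<le> ?Q w"
      using \<epsilon> y by (intro mult_left_mono cubic_le_quartic) auto
    finally show ?thesis .
  qed
  then have "\<bar>\<integral>w. ?L w - ?T w \<partial>?N\<bar> \<le> (\<integral>w. ?Q w \<partial>?N)"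
    by (intro order_trans[OF integral_abs_bound] integral_mono integrable_abs
        Bochner_Integration.integrable_diff int_L int_T int_Q)
  also have "(\<integral>w. ?Q w \<partial>?N) = 52 * \<epsilon> ^ 3 * (8 * (16 * E ^ 4 + 3))"
    using integrable_normal_power[of y 4] normal_moment_4[of y] N.prob_space by simp
  also have "\<dots> = (6656 * E ^ 4 + 1248) * \<epsilon> ^ 3" by (simp add: algebra_simps)
  finally have 1: "\<bar>(\<integral>w. ?L w \<partial>?N) - (\<integral>w. ?T w \<partial>?N)\<bar> \<le> (6656 * E ^ 4 + 1248) * \<epsilon> ^ 3"
    using int_L int_T by simp
  have "(\<integral>w. ?T w \<partial>?N) = m * y + (v - m\<^sup>2) / 2 * (1 + y\<^sup>2) - v / 2"
    unfolding T_eq using mono N.prob_space by simp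
  also have "\<dots> = (m * y - m\<^sup>2 / 2) + (v - m\<^sup>2) / 2 * y\<^sup>2"
    by (simp add: field_simps)
  finally have T: "(\<integral>w. ?T w \<partial>?N) = (m * y - m\<^sup>2 / 2) + (v - m\<^sup>2) / 2 * y\<^sup>2" .
  have a2: "(a t)\<^sup>2 \<le> \<epsilon>\<^sup>2" if "t \<in> space \<mu>" for t
    using a[OF that] by (metis abs_ge_zero power2_abs power_mono)
  have "\<bar>v\<bar> \<le> \<epsilon>\<^sup>2" unfolding v_def
    by (rule integral_abs_bound_prob[OF \<mu>]) (use a2 in auto)
  moreover have "0 \<le> v" unfolding v_def by simp
  moreover have "m\<^sup>2 \<le> \<epsilon>\<^sup>2"
  proof -
    have "\<bar>m\<bar> \<le> \<epsilon>" unfolding m_def by (rule integral_abs_bound_prob[OF \<mu> _ a]) auto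
    then show ?thesis by (metis abs_ge_zero power2_abs power_mono)
  qed
  ultimately have "v - m\<^sup>2 \<le> \<epsilon>\<^sup>2" "m\<^sup>2 - v \<le> \<epsilon>\<^sup>2"
    using zero_le_power2[of m] unfolding abs_le_iff by linarith+
  then have "\<bar>(v - m\<^sup>2) / 2\<bar> \<le> \<epsilon>\<^sup>2 / 2" by (simp add: abs_le_iff)
  moreover have "y\<^sup>2 \<le> \<epsilon> * E"
  proof -
    have "y\<^sup>2 \<le> \<epsilon>\<^sup>2" using y by (metis abs_ge_zero power2_abs power_mono)
    also have "\<dots> \<le> \<epsilon> * E" using \<epsilon> by (simp add: power2_eq_square mult_left_mono)
    finally show ?thesis .
  qed
  ultimately have "\<bar>(v - m\<^sup>2) / 2 * y\<^sup>2\<bar> \<le> \<epsilon>\<^sup>2 / 2 * (\<epsilon> * E)"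
    unfolding abs_mult by (intro mult_mono) auto
  also have "\<dots> = E / 2 * \<epsilon> ^ 3" by (simp add: power2_eq_square power3_eq_cube)
  finally have 2: "\<bar>(v - m\<^sup>2) / 2 * y\<^sup>2\<bar> \<le> E / 2 * \<epsilon> ^ 3" .
  have "1 \<le> E ^ 4" "E \<le> E ^ 4"
    using \<epsilon> power_increasing[of 1 4 E] by (auto simp: one_le_power)
  then have "(6656 * E ^ 4 + 1248 + E / 2) * \<epsilon> ^ 3 \<le> 8000 * E ^ 4 * \<epsilon> ^ 3"
    using \<epsilon> by (intro mult_right_mono) auto
  then have "(6656 * E ^ 4 + 1248) * \<epsilon> ^ 3 + E / 2 * \<epsilon> ^ 3 \<le> 8000 * E ^ 4 * \<epsilon> ^ 3"
    by (simp only: distrib_right)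
  with 1 2 show ?thesis unfolding T by linarith
qed

section \<open>One Bernoulli observation\<close>

text \<open>
  With \<open>q * b\<^sup>2 = 1 - q\<close> the first-order terms of the two logarithms cancel in the null model, their
  covariance with the planted signal is \<open>x * y\<close>, and the second-order terms add up to \<open>- x\<^sup>2 / 2\<close>, exactly
  as for a Gaussian observation. The remaining terms are of third order, and their weight
  \<open>q * b ^ 3 + (1 - q) / b ^ 3\<close> is the third absolute moment of the standardised Bernoulli variable.
\<close>

lemma bernoulli_expansion:
  fixes q b x y \<kappa> B \<epsilon> :: real
  assumes q: "0 < q" "q < 1" and b: "0 < b" "q * b\<^sup>2 = 1 - q"
    and \<kappa>: "0 < \<kappa>" "\<kappa> \<le> 1" "\<kappa> \<le> 1 + b * x" "\<kappa> \<le> 1 - x / b"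
    and x: "\<bar>x\<bar> \<le> \<epsilon>" and y: "\<bar>y\<bar> \<le> \<epsilon>" "\<bar>b * y\<bar> \<le> B" "\<bar>y / b\<bar> \<le> B"
  defines "p \<equiv> q + q * b * y" and "\<tau> \<equiv> q * b ^ 3 + (1 - q) / b ^ 3"
  shows "\<bar>p * ln (1 + b * x) + (1 - p) * ln (1 - x / b) - (x * y - x\<^sup>2 / 2)\<bar>
      \<le> ((1 + B) / (3 * \<kappa>) + 1 / 2) * \<tau> * \<epsilon> ^ 3"
proof -
  have \<epsilon>: "0 \<le> \<epsilon>" and B: "0 \<le> B" using x y by auto
  define R1 where "R1 = ln (1 + b * x) - b * x + (b * x)\<^sup>2 / 2"
  define R2 where "R2 = ln (1 + - x / b) - - x / b + (- x / b)\<^sup>2 / 2"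
  have p1: "p = q * (1 + b * y)" by (simp add: p_def algebra_simps)
  have "(1 - q) / b = q * b"
    using b by (simp add: field_simps power2_eq_square)
  then have p2: "1 - p = (1 - q) * (1 - y / b)"
    by (simp add: p_def right_diff_distrib) (metis times_divide_eq_left times_divide_eq_right)
  have cube: "\<bar>x\<bar> ^ 3 \<le> \<epsilon> ^ 3" using x by (intro power_mono) auto
  have "\<bar>p * R1\<bar> \<le> (q * (1 + B)) * ((b ^ 3 * \<epsilon> ^ 3) / (3 * \<kappa>))"
    unfolding abs_mult
  proof (intro mult_mono)
    show "\<bar>p\<bar> \<le> q * (1 + B)"
      unfolding p1 abs_mult using q y by (intro mult_mono) auto
    have "\<bar>R1\<bar> \<le> \<bar>b * x\<bar> ^ 3 / (3 * \<kappa>)"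
      unfolding R1_def using \<kappa> by (intro ln_third_order) auto
    also have "\<dots> \<le> (b ^ 3 * \<epsilon> ^ 3) / (3 * \<kappa>)"
      using cube b \<kappa> by (intro divide_right_mono) (auto simp: abs_mult power_mult_distrib)
    finally show "\<bar>R1\<bar> \<le> (b ^ 3 * \<epsilon> ^ 3) / (3 * \<kappa>)" .
  qed (use q B in auto)
  moreover have "\<bar>(1 - p) * R2\<bar> \<le> ((1 - q) * (1 + B)) * ((\<epsilon> ^ 3 / b ^ 3) / (3 * \<kappa>))"
    unfolding abs_mult
  proof (intro mult_mono)
    show "\<bar>1 - p\<bar> \<le> (1 - q) * (1 + B)"
      unfolding p2 abs_mult using q y(3) abs_triangle_ineq4[of 1 "y / b"]
      by (intro mult_mono) (auto simp del: abs_divide)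
    have "\<bar>R2\<bar> \<le> \<bar>- x / b\<bar> ^ 3 / (3 * \<kappa>)"
      unfolding R2_def using \<kappa> by (intro ln_third_order) auto
    also have "\<dots> \<le> (\<epsilon> ^ 3 / b ^ 3) / (3 * \<kappa>)"
      using cube b \<kappa> by (intro divide_right_mono) (auto simp: abs_divide power_divide intro: divide_right_mono)
    finally show "\<bar>R2\<bar> \<le> (\<epsilon> ^ 3 / b ^ 3) / (3 * \<kappa>)" .
  qed (use q B in auto)
  ultimately have rem: "\<bar>p * R1 + (1 - p) * R2\<bar> \<le> (1 + B) / (3 * \<kappa>) * \<tau> * \<epsilon> ^ 3"
  proof -
    have "(1 + B) / (3 * \<kappa>) * \<tau> * \<epsilon> ^ 3
        = (q * (1 + B)) * ((b ^ 3 * \<epsilon> ^ 3) / (3 * \<kappa>)) + ((1 - q) * (1 + B)) * ((\<epsilon> ^ 3 / b ^ 3) / (3 * \<kappa>))"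
      unfolding \<tau>_def using \<kappa> b by (simp add: field_simps)
    moreover assume "\<bar>p * R1\<bar> \<le> (q * (1 + B)) * ((b ^ 3 * \<epsilon> ^ 3) / (3 * \<kappa>))"
      "\<bar>(1 - p) * R2\<bar> \<le> ((1 - q) * (1 + B)) * ((\<epsilon> ^ 3 / b ^ 3) / (3 * \<kappa>))"
    ultimately show ?thesis
      using abs_triangle_ineq[of "p * R1" "(1 - p) * R2"] by linarith
  qed
  have main: "p * (b * x - (b * x)\<^sup>2 / 2) + (1 - p) * (- x / b - (- x / b)\<^sup>2 / 2)
      = (x * y - x\<^sup>2 / 2) - y * x\<^sup>2 / 2 * (q * b ^ 3 - (1 - q) / b ^ 3)"
  proof -
    \<comment> \<open>With an inverse of \<open>b\<close> as a variable, the claim is a polynomial identity modulo two relations.\<close>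
    define c where "c = 1 / b"
    have c: "b * c = 1" "x / b = c * x" "- x / b = - (c * x)" using b by (auto simp: c_def)
    have q1: "q + q * b\<^sup>2 = 1" using b by simp
    have "(1 - q) / b ^ 3 = q * b\<^sup>2 / b ^ 3" using b by simp
    also have "\<dots> = q * c" using b(1) by (simp add: c_def power2_eq_square power3_eq_cube)
    finally have qc: "(1 - q) / b ^ 3 = q * c" .
    have "(q + q * b * y) * (2 * (b * x) - (b * x)\<^sup>2)
        + (1 - (q + q * b * y)) * (- 2 * (c * x) - (c * x)\<^sup>2)
        = 2 * x * y - x\<^sup>2 - y * x\<^sup>2 * (q * b ^ 3 - q * c)"
      using c(1) q1 by algebra
    then show ?thesis
      unfolding p_def c(3) qc by (simp add: field_simps)
  qed
  have "\<bar>y * x\<^sup>2 / 2 * (q * b ^ 3 - (1 - q) / b ^ 3)\<bar> \<le> (\<epsilon> * \<epsilon>\<^sup>2 / 2) * \<tau>"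
    unfolding abs_mult abs_divide
  proof (intro mult_mono divide_mono)
    show "\<bar>x\<^sup>2\<bar> \<le> \<epsilon>\<^sup>2" using x by (metis abs_ge_zero abs_power2 power2_abs power_mono)
    have "0 \<le> q * b ^ 3" "0 \<le> (1 - q) / b ^ 3" using q b by auto
    then show "\<bar>q * b ^ 3 - (1 - q) / b ^ 3\<bar> \<le> \<tau>" unfolding \<tau>_def by linarith
  qed (use y \<epsilon> in auto)
  also have "\<dots> = 1 / 2 * \<tau> * \<epsilon> ^ 3" by (simp add: power2_eq_square power3_eq_cube)
  finally have cross: "\<bar>y * x\<^sup>2 / 2 * (q * b ^ 3 - (1 - q) / b ^ 3)\<bar> \<le> 1 / 2 * \<tau> * \<epsilon> ^ 3" .
  have "p * ln (1 + b * x) + (1 - p) * ln (1 - x / b) - (x * y - x\<^sup>2 / 2)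
      = (p * R1 + (1 - p) * R2) - y * x\<^sup>2 / 2 * (q * b ^ 3 - (1 - q) / b ^ 3)"
  proof -
    have "ln (1 + b * x) = R1 + (b * x - (b * x)\<^sup>2 / 2)"
      and "ln (1 - x / b) = R2 + (- x / b - (- x / b)\<^sup>2 / 2)"
      by (simp_all add: R1_def R2_def)
    then have "p * ln (1 + b * x) + (1 - p) * ln (1 - x / b) = (p * R1 + (1 - p) * R2)
      + (p * (b * x - (b * x)\<^sup>2 / 2) + (1 - p) * (- x / b - (- x / b)\<^sup>2 / 2))"
      by (simp only: distrib_left)
    then show ?thesis unfolding main by simp
  qed
  then have "\<bar>p * ln (1 + b * x) + (1 - p) * ln (1 - x / b) - (x * y - x\<^sup>2 / 2)\<bar>
      \<le> (1 + B) / (3 * \<kappa>) * \<tau> * \<epsilon> ^ 3 + 1 / 2 * \<tau> * \<epsilon> ^ 3"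
    using rem cross by linarith
  also have "\<dots> = ((1 + B) / (3 * \<kappa>) + 1 / 2) * \<tau> * \<epsilon> ^ 3" by (simp only: distrib_right)
  finally show ?thesis .
qed

text \<open>
  The two likelihood ratios are affine in \<open>a\<close>. Averaging them over \<open>\<mu>\<close> therefore only replaces \<open>a\<close> by its
  mean \<open>m\<close>, and the scalar expansion applies with no error from the fluctuations of \<open>a\<close>.
\<close>

lemma bernoulli_log_partition_expansion:
  fixes a :: "'t \<Rightarrow> real"
  assumes \<mu>: "prob_space \<mu>" and a_meas[measurable]: "a \<in> borel_measurable \<mu>"
    and a: "\<And>t. t \<in> space \<mu> \<Longrightarrow> \<bar>a t\<bar> \<le> \<epsilon>"
    and q: "0 < q" "q < 1" and b: "0 < b" "q * b\<^sup>2 = 1 - q"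
    and \<kappa>: "0 < \<kappa>" "\<kappa> \<le> 1"
      "\<And>t. t \<in> space \<mu> \<Longrightarrow> \<kappa> \<le> 1 + b * a t" "\<And>t. t \<in> space \<mu> \<Longrightarrow> \<kappa> \<le> 1 - a t / b"
    and y: "\<bar>y\<bar> \<le> \<epsilon>" "\<bar>b * y\<bar> \<le> B" "\<bar>y / b\<bar> \<le> B" and p: "0 \<le> q + q * b * y" "q + q * b * y \<le> 1"
  defines "m \<equiv> \<integral>t. a t \<partial>\<mu>"
  shows "\<bar>(\<integral>g. log_partition \<mu> (\<lambda>t. of_bool g * ln (1 + b * a t) + (1 - of_bool g) * ln (1 - a t / b))
        \<partial>measure_pmf (bernoulli_pmf (q + q * b * y))) - (m * y - m\<^sup>2 / 2)\<bar>
      \<le> ((1 + B) / (3 * \<kappa>) + 1 / 2) * (q * b ^ 3 + (1 - q) / b ^ 3) * \<epsilon> ^ 3"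
proof -
  interpret prob_space \<mu> by fact
  have int_a: "integrable \<mu> a"
    by (rule integrable_bounded_prob[OF \<mu> a_meas a])
  have pos: "0 < 1 + b * a t" "0 < 1 - a t / b" if "t \<in> space \<mu>" for t
    using \<kappa>(1) \<kappa>(3,4)[OF that] by linarith+
  have "(\<integral>t. exp (ln (1 + b * a t)) \<partial>\<mu>) = (\<integral>t. 1 + b * a t \<partial>\<mu>)"
    using pos by (intro Bochner_Integration.integral_cong) auto
  also have "\<dots> = 1 + b * m" using int_a prob_space by (simp add: m_def)
  finally have T: "log_partition \<mu> (\<lambda>t. ln (1 + b * a t)) = ln (1 + b * m)"
    unfolding log_partition_def by simp
  have "(\<integral>t. exp (ln (1 - a t / b)) \<partial>\<mu>) = (\<integral>t. 1 - a t / b \<partial>\<mu>)"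
    using pos by (intro Bochner_Integration.integral_cong) auto
  also have "\<dots> = 1 - m / b" using int_a prob_space by (simp add: m_def)
  finally have F: "log_partition \<mu> (\<lambda>t. ln (1 - a t / b)) = ln (1 - m / b)"
    unfolding log_partition_def by simp
  have m: "\<bar>m\<bar> \<le> \<epsilon>" unfolding m_def by (rule integral_abs_bound_prob[OF \<mu> a_meas a])
  have "\<kappa> \<le> (\<integral>t. 1 + b * a t \<partial>\<mu>)"
    by (rule integral_ge_const) (use \<kappa> int_a in auto)
  moreover have "\<kappa> \<le> (\<integral>t. 1 - a t / b \<partial>\<mu>)"
    by (rule integral_ge_const) (use \<kappa> int_a in auto)
  ultimately have \<kappa>m: "\<kappa> \<le> 1 + b * m" "\<kappa> \<le> 1 - m / b"
    using int_a prob_space by (simp_all add: m_def)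
  show ?thesis
    using bernoulli_expansion[OF q b \<kappa>(1,2) \<kappa>m m y] p
    by (simp add: T F mult.commute)
qed

lemma bernoulli_envelope:
  assumes "prob_space \<pi>" and [measurable]: "a \<in> borel_measurable \<pi>"
    and a: "\<And>t. t \<in> space \<pi> \<Longrightarrow> \<bar>a t\<bar> \<le> \<epsilon>" and b: "0 < b" and \<kappa>: "0 < \<kappa>" "\<kappa> \<le> 1"
      "\<And>t. t \<in> space \<pi> \<Longrightarrow> \<kappa> \<le> 1 + b * a t" "\<And>t. t \<in> space \<pi> \<Longrightarrow> \<kappa> \<le> 1 - a t / b"
  shows "has_envelope (measure_pmf P) \<pi>
    (\<lambda>g t. of_bool g * ln (1 + b * a t) + (1 - of_bool g) * ln (1 - a t / b))
    (\<lambda>_. - ln \<kappa> + b * \<epsilon> + \<epsilon> / b)"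
  unfolding has_envelope_def
proof (intro conjI ballI)
  show "(\<lambda>(g, t). of_bool g * ln (1 + b * a t) + (1 - of_bool g) * ln (1 - a t / b))
      \<in> borel_measurable (measure_pmf P \<Otimes>\<^sub>M \<pi>)"
  proof -
    have [measurable]: "(of_bool :: bool \<Rightarrow> real) \<in> borel_measurable (measure_pmf P)" by simp
    show ?thesis by measurable
  qed
  show "integrable (measure_pmf P) (\<lambda>_. - ln \<kappa> + b * \<epsilon> + \<epsilon> / b)" by simp
  fix g t assume t: "t \<in> space \<pi>"
  have \<epsilon>: "0 \<le> \<epsilon>" using a[OF t] by linarith
  have ln_le: "\<bar>ln (1 + r)\<bar> \<le> - ln \<kappa> + R" if "\<kappa> \<le> 1 + r" "\<bar>r\<bar> \<le> R" for r R
  proof -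
    have "ln \<kappa> \<le> ln (1 + r)" "ln (1 + r) \<le> r" "ln \<kappa> \<le> 0"
      using that \<kappa> ln_add_one_self_le_self2[of r] by auto
    then show ?thesis using that by linarith
  qed
  have "\<bar>b * a t\<bar> \<le> b * \<epsilon>" using a[OF t] b by (simp add: abs_mult)
  then have 1: "\<bar>ln (1 + b * a t)\<bar> \<le> - ln \<kappa> + b * \<epsilon>" using \<kappa>(3)[OF t] by (rule ln_le[rotated])
  have "\<bar>- a t / b\<bar> \<le> \<epsilon> / b" using a[OF t] b by (simp add: abs_divide divide_right_mono)
  then have 2: "\<bar>ln (1 - a t / b)\<bar> \<le> - ln \<kappa> + \<epsilon> / b"
    using ln_le[of "- a t / b" "\<epsilon> / b"] \<kappa>(4)[OF t] by simp
  have "0 \<le> b * \<epsilon>" "0 \<le> \<epsilon> / b" using b \<epsilon> by auto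
  then show "\<bar>of_bool g * ln (1 + b * a t) + (1 - of_bool g) * ln (1 - a t / b)\<bar>
      \<le> - ln \<kappa> + b * \<epsilon> + \<epsilon> / b"
    using 1 2 by (cases g) auto
qed

section \<open>The tensor signal\<close>

lemma zsig_expand:
  "zsig J n \<alpha> u = (\<Sum>\<beta>\<in>UNIV. J n \<alpha> $ \<beta> *
     (real n powr ((1 - real CARD('p)) / 2) * (\<Prod>k\<in>UNIV. u (\<alpha> k) $ \<beta> k)))"
  for \<alpha> :: "'p::finite \<Rightarrow> nat"
  by (simp add: zsig_def eta_def pure_tensor_def inner_vec_def)

lemma continuous_on_zsig:
  fixes J :: "('p::finite, 'd::finite) couplings"
  shows "continuous_on T (zsig J n \<alpha>)"
proof -
  have coord: "continuous_on T (\<lambda>u::nat \<Rightarrow> real ^ 'd. u i)" for i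
    by (rule continuous_on_subset[OF continuous_on_product_coordinates]) simp
  show ?thesis
    unfolding zsig_expand
    by (intro continuous_on_sum continuous_on_mult continuous_on_const continuous_on_prod
        continuous_on_component coord)
qed

lemma compact_params: "compact (params n :: (nat \<Rightarrow> real ^ 'd::finite) set)"
proof -
  have cube: "cube = cbox (- 1) (1 :: real ^ 'd)"
    by (auto simp: cube_def mem_box_cart)
  \<comment> \<open>Functions in \<open>params n\<close> are \<open>undefined\<close> off \<open>{1..n}\<close>, so Tychonoff applies with singleton factors there.\<close>
  have "params n = PiE UNIV (\<lambda>i. if i \<in> {1..n} then cube else {undefined :: real ^ 'd})"
    by (auto simp: params_def PiE_def Pi_def extensional_def)
  moreover have "compactin (product_topology (\<lambda>_::nat. euclidean :: (real ^ 'd) topology) UNIV)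
      (PiE UNIV (\<lambda>i. if i \<in> {1..n} then cube else {undefined :: real ^ 'd}))"
    unfolding compactin_PiE by (auto simp: cube)
  ultimately show ?thesis by (simp add: euclidean_product_topology)
qed

lemma space_prior: "prior n \<pi> \<Longrightarrow> space \<pi> = params n"
  using sets_eq_imp_space_eq[of \<pi>]
  by (auto simp: prior_def space_PiM params_def space_restrict_space)

lemma measurable_zsig:
  fixes \<alpha> :: "'p::finite \<Rightarrow> nat" and \<pi> :: "(nat \<Rightarrow> real ^ 'd::finite) measure"
  assumes \<pi>: "prior n \<pi>" and \<alpha>: "\<alpha> \<in> multi_indices n"
  shows "zsig J n \<alpha> \<in> borel_measurable \<pi>"
proof -
  have "(\<lambda>u. u (\<alpha> k) $ j) \<in> borel_measurable (\<Pi>\<^sub>M i\<in>{1..n}. restrict_space borel (cube :: (real ^ 'd) set))" for k j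
  proof -
    have "(\<lambda>u. u (\<alpha> k)) \<in> measurable (\<Pi>\<^sub>M i\<in>{1..n}. restrict_space borel cube) (restrict_space borel (cube :: (real ^ 'd) set))"
      using \<alpha> by (intro measurable_component_singleton) (auto simp: multi_indices_def)
    moreover have "(\<lambda>x. x $ j) \<in> borel_measurable (restrict_space borel (cube :: (real ^ 'd) set))"
      by (intro measurable_restrict_space1) measurable
    ultimately show ?thesis by (rule measurable_compose)
  qed
  then have "zsig J n \<alpha> \<in> borel_measurable (\<Pi>\<^sub>M i\<in>{1..n}. restrict_space borel (cube :: (real ^ 'd) set))"
    unfolding zsig_expand by (intro borel_measurable_sum borel_measurable_times borel_measurable_prod) auto
  moreover have "measurable \<pi> (borel :: real measure)
      = measurable (\<Pi>\<^sub>M i\<in>{1..n}. restrict_space borel (cube :: (real ^ 'd) set)) borel"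
    using \<pi> by (intro measurable_cong_sets) (simp_all add: prior_def)
  ultimately show ?thesis by simp
qed

lemma finite_multi_indices: "finite (multi_indices n :: ('p::finite \<Rightarrow> nat) set)"
  unfolding multi_indices_def by (intro finite_PiE) auto

lemma card_multi_indices:
  "real (card (multi_indices n :: ('p::finite \<Rightarrow> nat) set)) = real n * edge_scale CARD('p) n"
proof -
  have "card (multi_indices n :: ('p \<Rightarrow> nat) set) = n ^ CARD('p)"
    unfolding multi_indices_def by (simp add: card_PiE)
  also have "\<dots> = n * n ^ (CARD('p) - 1)"
    by (metis Suc_diff_1 power_Suc zero_less_card_finite)
  finally show ?thesis by (simp add: edge_scale_def)
qed

lemma abs_zsig_le:
  fixes J :: "('p::finite, 'd::finite) couplings"
  assumes n: "n \<ge> 1" and \<alpha>: "\<alpha> \<in> multi_indices n" and u: "u \<in> params n" and J: "norm (J n \<alpha>) \<le> K"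
  shows "\<bar>zsig J n \<alpha> u\<bar> \<le> K * CARD('p \<Rightarrow> 'd) / sqrt (edge_scale CARD('p) n)"
proof -
  have "u (\<alpha> k) \<in> cube" for k
    using \<alpha> u by (auto simp: multi_indices_def params_def PiE_def Pi_def)
  then have "u (\<alpha> k) $ j \<in> {-1..1}" for k j
    by (simp add: cube_def)
  then have "\<bar>u (\<alpha> k) $ j\<bar> \<le> 1" for k j
    by (metis abs_le_iff atLeastAtMost_iff minus_le_iff)
  then have "(\<Prod>k\<in>UNIV. \<bar>u (\<alpha> k) $ \<beta> k\<bar>) \<le> 1" for \<beta>
    by (intro prod_le_1) auto
  then have "norm (pure_tensor (\<lambda>k. u (\<alpha> k))) \<le> (\<Sum>\<beta>\<in>(UNIV :: ('p \<Rightarrow> 'd) set). 1)"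
    by (intro order_trans[OF norm_le_l1_cart] sum_mono) (simp add: pure_tensor_def abs_prod)
  then have tensor: "norm (pure_tensor (\<lambda>k. u (\<alpha> k))) \<le> CARD('p \<Rightarrow> 'd)" by simp
  have s: "0 \<le> edge_scale CARD('p) n" by (simp add: edge_scale_def)
  have scale: "real n powr ((1 - real CARD('p)) / 2) = 1 / sqrt (edge_scale CARD('p) n)"
  proof -
    have "(1 - real CARD('p)) / 2 = - (real (CARD('p) - 1) * (1 / 2))"
      by (simp add: of_nat_diff Suc_leI field_simps)
    then have "real n powr ((1 - real CARD('p)) / 2) = inverse ((real n powr real (CARD('p) - 1)) powr (1 / 2))"
      by (simp only: powr_minus powr_powr)
    also have "real n powr real (CARD('p) - 1) = edge_scale CARD('p) n"
      using n unfolding edge_scale_def by (intro powr_realpow) auto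
    finally show ?thesis by (simp only: powr_half_sqrt[OF s] inverse_eq_divide)
  qed
  have "norm (eta n \<alpha> u) = norm (pure_tensor (\<lambda>k. u (\<alpha> k))) / sqrt (edge_scale CARD('p) n)"
    unfolding eta_def norm_scaleR scale using s by simp
  also have "\<dots> \<le> CARD('p \<Rightarrow> 'd) / sqrt (edge_scale CARD('p) n)"
    using tensor s by (intro divide_right_mono) auto
  finally have "norm (eta n \<alpha> u) \<le> CARD('p \<Rightarrow> 'd) / sqrt (edge_scale CARD('p) n)" .
  moreover have "0 \<le> K" using J norm_ge_zero[of "J n \<alpha>"] by linarith
  ultimately have "norm (J n \<alpha>) * norm (eta n \<alpha> u) \<le> K * (CARD('p \<Rightarrow> 'd) / sqrt (edge_scale CARD('p) n))"
    using J by (intro mult_mono) auto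
  then show ?thesis
    unfolding zsig_def using Cauchy_Schwarz_ineq2[of "J n \<alpha>" "eta n \<alpha> u"] by simp
qed

section \<open>The gap for a fixed size\<close>

text \<open>
  Both channels have the expansion \<open>m * y - m\<^sup>2 / 2\<close> with the same mean \<open>m\<close>, so replacing one coordinate
  costs only the two third-order errors. The factor in front is the number \<open>n ^ p\<close> of coordinates divided
  by \<open>n\<close>.
\<close>

lemma free_energy_gap:
  fixes J :: "('p::finite, 'd::finite) couplings" and D :: "nat \<Rightarrow> real"
  assumes n: "n \<ge> 1" and \<pi>: "prior n \<pi>" and \<theta>: "\<theta> \<in> params n"
    and lam: "0 \<le> lam" "0 \<le> lam_star" and D: "D n \<in> {0<..<edge_scale CARD('p) n}"
  defines "b \<equiv> bcoef CARD('p) D n" and "q \<equiv> D n / edge_scale CARD('p) n"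
  assumes \<epsilon>: "0 \<le> \<epsilon>" "\<epsilon> \<le> E" "1 \<le> E" "b * \<epsilon> \<le> B" "\<epsilon> / b \<le> B"
    and small: "\<And>\<alpha> u. \<alpha> \<in> multi_indices n \<Longrightarrow> u \<in> params n \<Longrightarrow>
        \<bar>sqrt lam * zsig J n \<alpha> u\<bar> \<le> \<epsilon> \<and> \<bar>sqrt lam_star * zsig J n \<alpha> u\<bar> \<le> \<epsilon>"
    and \<kappa>: "0 < \<kappa>" "\<kappa> \<le> 1"
    and lower: "\<And>\<alpha> u. \<alpha> \<in> multi_indices n \<Longrightarrow> u \<in> params n \<Longrightarrow>
        \<kappa> \<le> 1 + b * sqrt lam * zsig J n \<alpha> u \<and> \<kappa> \<le> 1 - sqrt lam * zsig J n \<alpha> u / b"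
    and channel: "channel_well_defined J D lam_star"
  shows "\<bar>bernoulli_free_energy J D lam lam_star n \<pi> \<theta> - gaussian_free_energy J lam lam_star n \<pi> \<theta>\<bar>
    \<le> edge_scale CARD('p) n *
      ((((1 + B) / (3 * \<kappa>) + 1 / 2) * (q * b ^ 3 + (1 - q) / b ^ 3) + 8000 * E ^ 4) * \<epsilon> ^ 3)"
proof -
  let ?s = "edge_scale CARD('p) n"
  let ?I = "multi_indices n :: ('p \<Rightarrow> nat) set"
  define e where "e = (((1 + B) / (3 * \<kappa>) + 1 / 2) * (q * b ^ 3 + (1 - q) / b ^ 3) + 8000 * E ^ 4) * \<epsilon> ^ 3"
  have prob: "prob_space \<pi>" using \<pi> by (simp add: prior_def)
  note space = space_prior[OF \<pi>]
  have q: "0 < q" "q < 1" using D by (auto simp: q_def)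
  have "(?s - D n) / D n = (1 - q) / q"
    using D by (simp add: q_def field_simps)
  then have b_eq: "b = sqrt ((1 - q) / q)" by (simp add: b_def bcoef_def)
  then have b: "0 < b" "q * b\<^sup>2 = 1 - q" using q by auto
  define a where "a = (\<lambda>\<alpha> t. sqrt lam * zsig J n \<alpha> t)"
  define y where "y = (\<lambda>\<alpha>. sqrt lam_star * zsig J n \<alpha> \<theta>)"
  define M where "M = (\<lambda>\<alpha>. measure_pmf (bernoulli_pmf (success_prob J D lam_star n \<theta> \<alpha>)))"
  define N where "N = (\<lambda>\<alpha>. density lborel (\<lambda>x. ennreal (normal_density (y \<alpha>) 1 x)))"
  define h where "h = (\<lambda>\<alpha> g t. of_bool g * ln (1 + b * a \<alpha> t) + (1 - of_bool g) * ln (1 - a \<alpha> t / b))"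
  define k where "k = (\<lambda>\<alpha> w t. w * a \<alpha> t - (a \<alpha> t)\<^sup>2 / 2)"
  have a_meas: "a \<alpha> \<in> borel_measurable \<pi>" if "\<alpha> \<in> ?I" for \<alpha>
    unfolding a_def using measurable_zsig[OF \<pi> that] by simp
  have a_le: "\<bar>a \<alpha> t\<bar> \<le> \<epsilon>" if "\<alpha> \<in> ?I" "t \<in> space \<pi>" for \<alpha> t
    using small[of \<alpha> t] that by (simp add: a_def space)
  have a_lower: "\<kappa> \<le> 1 + b * a \<alpha> t" "\<kappa> \<le> 1 - a \<alpha> t / b" if "\<alpha> \<in> ?I" "t \<in> space \<pi>" for \<alpha> t
    using lower[of \<alpha> t] that by (simp_all add: a_def space mult.assoc)
  have y_le: "\<bar>y \<alpha>\<bar> \<le> \<epsilon>" if "\<alpha> \<in> ?I" for \<alpha>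
    using small[OF that \<theta>] by (simp add: y_def)
  have y_b: "\<bar>b * y \<alpha>\<bar> \<le> B" "\<bar>y \<alpha> / b\<bar> \<le> B" if "\<alpha> \<in> ?I" for \<alpha>
  proof -
    have "\<bar>b * y \<alpha>\<bar> \<le> b * \<epsilon>" "\<bar>y \<alpha> / b\<bar> \<le> \<epsilon> / b"
      using y_le[OF that] b(1) by (simp_all add: abs_mult abs_divide divide_right_mono)
    then show "\<bar>b * y \<alpha>\<bar> \<le> B" "\<bar>y \<alpha> / b\<bar> \<le> B" using \<epsilon>(4,5) by linarith+
  qed
  have success: "success_prob J D lam_star n \<theta> \<alpha> = q + q * b * y \<alpha>" for \<alpha>
  proof -
    have "(q * b)\<^sup>2 = q * (1 - q)"
      using b(2) by (metis power_mult_distrib power2_eq_square mult.assoc)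
    then have "sqrt (q * (1 - q)) = q * b"
      using q b by (intro real_sqrt_unique) auto
    then show ?thesis by (simp add: success_prob_def q_def[symmetric] y_def mult.assoc)
  qed
  have p: "0 \<le> q + q * b * y \<alpha>" "q + q * b * y \<alpha> \<le> 1" if "\<alpha> \<in> ?I" for \<alpha>
  proof -
    have "0 < 1 + b * y \<alpha>" "0 < 1 - y \<alpha> / b"
      using channel n that \<theta> unfolding channel_well_defined_def b_def y_def by (auto simp: mult.assoc)
    then have "0 < q * (1 + b * y \<alpha>)" "0 < q * b\<^sup>2 * (1 - y \<alpha> / b)" using q b by auto
    moreover have "q * b\<^sup>2 * (1 - y \<alpha> / b) = q * b\<^sup>2 - q * b * y \<alpha>"
      using b(1) by (simp add: right_diff_distrib power2_eq_square)
    ultimately show "0 \<le> q + q * b * y \<alpha>" "q + q * b * y \<alpha> \<le> 1"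
      using b(2) by (auto simp: distrib_left mult.assoc)
  qed
  have PM: "prob_space (M \<alpha>)" and PN: "prob_space (N \<alpha>)" for \<alpha>
    unfolding M_def N_def by (auto intro: prob_space_measure_pmf prob_space_normal_density)
  have "\<bar>(\<integral>g. log_partition \<pi> (\<lambda>t. \<Sum>\<alpha>\<in>?I. h \<alpha> (g \<alpha>) t) \<partial>PiM ?I M)
      - (\<integral>w. log_partition \<pi> (\<lambda>t. \<Sum>\<alpha>\<in>?I. k \<alpha> (w \<alpha>) t) \<partial>PiM ?I N)\<bar> \<le> (\<Sum>\<alpha>\<in>?I. e)"
  proof (rule lindeberg_log_partition[OF prob finite_multi_indices PM PN])
    fix \<alpha> assume \<alpha>: "\<alpha> \<in> ?I"
    show "has_envelope (M \<alpha>) \<pi> (h \<alpha>) (\<lambda>_. - ln \<kappa> + b * \<epsilon> + \<epsilon> / b)"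
      unfolding M_def h_def
      by (rule bernoulli_envelope[OF prob a_meas[OF \<alpha>] a_le[OF \<alpha>] b(1) \<kappa> a_lower[OF \<alpha>]])
    show "has_envelope (N \<alpha>) \<pi> (k \<alpha>) (\<lambda>w. \<epsilon> * \<bar>w\<bar> + \<epsilon>\<^sup>2 / 2)"
      unfolding N_def k_def by (rule gaussian_envelope[OF prob a_meas[OF \<alpha>] a_le[OF \<alpha>]])
    fix \<mu> :: "(nat \<Rightarrow> real ^ 'd) measure" assume \<mu>: "prob_space \<mu>" "sets \<mu> = sets \<pi>"
    have sp: "space \<mu> = space \<pi>" by (rule sets_eq_imp_space_eq[OF \<mu>(2)])
    have meas: "a \<alpha> \<in> borel_measurable \<mu>"
      using a_meas[OF \<alpha>] \<mu>(2) by (metis measurable_cong_sets)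
    define m where "m = (\<integral>t. a \<alpha> t \<partial>\<mu>)"
    have "\<bar>(\<integral>g. log_partition \<mu> (h \<alpha> g) \<partial>M \<alpha>) - (m * y \<alpha> - m\<^sup>2 / 2)\<bar>
        \<le> ((1 + B) / (3 * \<kappa>) + 1 / 2) * (q * b ^ 3 + (1 - q) / b ^ 3) * \<epsilon> ^ 3"
      unfolding M_def h_def success m_def
      by (rule bernoulli_log_partition_expansion[OF \<mu>(1) meas _ q b \<kappa> _ _ y_le[OF \<alpha>] y_b[OF \<alpha>] p[OF \<alpha>]])
        (use a_le[OF \<alpha>] a_lower[OF \<alpha>] in \<open>auto simp: sp\<close>)
    moreover have "\<bar>(\<integral>w. log_partition \<mu> (k \<alpha> w) \<partial>N \<alpha>) - (m * y \<alpha> - m\<^sup>2 / 2)\<bar> \<le> 8000 * E ^ 4 * \<epsilon> ^ 3"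
      unfolding N_def k_def m_def
      by (rule gaussian_channel_expansion[OF \<mu>(1) meas _ \<epsilon>(1,2,3) y_le[OF \<alpha>]])
        (use a_le[OF \<alpha>] in \<open>auto simp: sp\<close>)
    ultimately show "\<bar>(\<integral>g. log_partition \<mu> (h \<alpha> g) \<partial>M \<alpha>) - (\<integral>w. log_partition \<mu> (k \<alpha> w) \<partial>N \<alpha>)\<bar> \<le> e"
      unfolding e_def distrib_right by linarith
  qed
  also have "(\<Sum>\<alpha>\<in>?I. e) = real n * (?s * e)"
    using card_multi_indices[where 'p='p, of n] by simp
  finally have gap: "\<bar>(\<integral>g. log_partition \<pi> (\<lambda>t. \<Sum>\<alpha>\<in>?I. h \<alpha> (g \<alpha>) t) \<partial>PiM ?I M)
      - (\<integral>w. log_partition \<pi> (\<lambda>t. \<Sum>\<alpha>\<in>?I. k \<alpha> (w \<alpha>) t) \<partial>PiM ?I N)\<bar> \<le> real n * (?s * e)" .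
  have B: "bernoulli_free_energy J D lam lam_star n \<pi> \<theta>
      = 1 / real n * (\<integral>g. log_partition \<pi> (\<lambda>t. \<Sum>\<alpha>\<in>?I. h \<alpha> (g \<alpha>) t) \<partial>PiM ?I M)"
    unfolding bernoulli_free_energy_def free_energy_def bernoulli_law_def bernoulli_loglik_def
      log_partition_def M_def h_def a_def b_def by (simp add: mult.assoc)
  have G: "gaussian_free_energy J lam lam_star n \<pi> \<theta>
      = 1 / real n * (\<integral>w. log_partition \<pi> (\<lambda>t. \<Sum>\<alpha>\<in>?I. k \<alpha> (w \<alpha>) t) \<partial>PiM ?I N)"
    unfolding gaussian_free_energy_def free_energy_def gaussian_law_def gaussian_loglik_def
      log_partition_def N_def k_def a_def y_def using lam by (simp add: power_mult_distrib ac_simps)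
  have "\<bar>1 / real n * X - 1 / real n * Y\<bar> \<le> ?s * e" if "\<bar>X - Y\<bar> \<le> real n * (?s * e)" for X Y
  proof -
    have "\<bar>1 / real n * X - 1 / real n * Y\<bar> = 1 / real n * \<bar>X - Y\<bar>"
      unfolding right_diff_distrib[symmetric] abs_mult by simp
    also have "\<dots> \<le> 1 / real n * (real n * (?s * e))"
      using that by (intro mult_left_mono) auto
    finally show ?thesis using n by simp
  qed
  from this[OF gap] show ?thesis
    unfolding B G e_def .
qed

section \<open>Constants that are uniform in the size\<close>

text \<open>
  Turns estimates that are uniform only for large sizes into estimates for all sizes, at the price of a
  worse constant: the finitely many small sizes are treated one at a time.
\<close>

lemma eventually_for_all_sizes:
  fixes P :: "nat \<Rightarrow> 'a \<Rightarrow> bool"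
  assumes each: "\<And>n. n \<ge> 1 \<Longrightarrow> eventually (P n) F"
    and tail: "eventually (\<lambda>x. \<forall>n\<ge>n0. P n x) F"
  shows "eventually (\<lambda>x. \<forall>n\<ge>1. P n x) F"
proof -
  have "eventually (\<lambda>x. \<forall>n\<in>{1..<n0}. P n x) F"
    by (intro eventually_ball_finite) (use each in auto)
  with tail show ?thesis
    by eventually_elim (metis atLeastLessThan_iff not_le)
qed

lemma eventually_le_on_compact:
  fixes f :: "'a::topological_space \<Rightarrow> real"
  assumes T: "compact T" and f: "continuous_on T f" and pos: "\<And>u. u \<in> T \<Longrightarrow> 0 < f u"
  shows "\<forall>\<^sub>F \<kappa> in at_right 0. \<forall>u\<in>T. \<kappa> \<le> f u"
proof (cases "T = {}")
  case False
  then obtain m where m: "m \<in> T" "\<And>u. u \<in> T \<Longrightarrow> f m \<le> f u"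
    using continuous_attains_inf[OF T _ f] by blast
  show ?thesis
    by (rule eventually_at_rightI[of 0 "f m"]) (use m pos in \<open>force+\<close>)
qed simp

lemma couplings_uniformly_bounded:
  fixes J :: "('p::finite, 'd::finite) couplings"
  assumes "(\<lambda>n. SUP \<alpha>\<in>multi_indices n. norm (J n \<alpha>)) \<in> O(\<lambda>_. 1)"
  obtains K where "0 \<le> K" "\<And>n \<alpha>. n \<ge> 1 \<Longrightarrow> \<alpha> \<in> multi_indices n \<Longrightarrow> norm (J n \<alpha>) \<le> K"
proof -
  obtain c where "\<forall>\<^sub>F n in sequentially. \<bar>SUP \<alpha>\<in>multi_indices n. norm (J n \<alpha>)\<bar> \<le> c"
    using assms by (auto elim!: landau_o.bigE)
  then obtain n0 where n0: "\<And>n. n \<ge> n0 \<Longrightarrow> \<bar>SUP \<alpha>\<in>multi_indices n. norm (J n \<alpha>)\<bar> \<le> c"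
    by (auto simp: eventually_sequentially)
  have bound: "norm (J n \<alpha>) \<le> c" if "n \<ge> n0" "\<alpha> \<in> multi_indices n" for n \<alpha>
  proof -
    have "norm (J n \<alpha>) \<le> (SUP \<alpha>\<in>multi_indices n. norm (J n \<alpha>))"
      by (intro cSUP_upper that bdd_above_finite finite_imageI finite_multi_indices)
    then show ?thesis using n0[OF that(1)] by linarith
  qed
  have "\<forall>\<^sub>F K in at_top. \<forall>n\<ge>n0. \<forall>\<alpha>\<in>multi_indices n. norm (J n \<alpha>) \<le> K"
    by (rule eventually_mono[OF eventually_ge_at_top[of c]]) (meson bound order_trans)
  then have "\<forall>\<^sub>F K in at_top. \<forall>n\<ge>1. \<forall>\<alpha>\<in>multi_indices n. norm (J n \<alpha>) \<le> K"
    by (intro eventually_for_all_sizes eventually_ball_finite finite_multi_indices ballI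
        eventually_ge_at_top)
  then have "\<forall>\<^sub>F K in at_top. 0 \<le> K \<and> (\<forall>n\<ge>1. \<forall>\<alpha>\<in>multi_indices n. norm (J n \<alpha>) \<le> K)"
    by (intro eventually_conj eventually_ge_at_top)
  then obtain K where "0 \<le> K \<and> (\<forall>n\<ge>1. \<forall>\<alpha>\<in>multi_indices n. norm (J n \<alpha>) \<le> K)"
    using eventually_happens'[OF trivial_limit_at_top_linorder] by blast
  then show thesis by (auto intro: that)
qed

lemma error_rate_tendsto_0:
  assumes "filterlim D at_top sequentially"
    and "filterlim (\<lambda>n. edge_scale p n - D n) at_top sequentially"
  shows "(error_rate p D \<longlongrightarrow> 0) sequentially"
proof -
  have "((\<lambda>n. 1 / sqrt (f n)) \<longlongrightarrow> 0) sequentially" if "filterlim f at_top sequentially" for f :: "nat \<Rightarrow> real"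
    by (rule tendsto_divide_0[OF tendsto_const filterlim_at_top_imp_at_infinity[OF filterlim_compose[OF sqrt_at_top that]]])
  from tendsto_add[OF this[OF assms(1)] this[OF assms(2)]] show ?thesis
    unfolding error_rate_def by simp
qed

text \<open>
  The third moment, and the constant \<open>1\<close> that weights the Gaussian error, are at most \<open>sqrt s * \<delta>\<close>.
  Multiplied by the cube of a signal of order \<open>1 / sqrt s\<close> this gives \<open>\<delta> / s\<close> for each coordinate.
\<close>

lemma sparse_scaling:
  fixes s D :: real
  assumes D: "0 < D" "D < s"
  defines "b \<equiv> sqrt ((s - D) / D)" and "q \<equiv> D / s" and "\<delta> \<equiv> 1 / sqrt D + 1 / sqrt (s - D)"
  shows "0 < b" "b \<le> sqrt s * \<delta>" "1 / b \<le> sqrt s * \<delta>" "1 \<le> sqrt s * \<delta>"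
    "q * b ^ 3 + (1 - q) / b ^ 3 \<le> sqrt s * \<delta>"
proof -
  have q: "0 < q" "q < 1" using D by (auto simp: q_def)
  have expand: "sqrt s * \<delta> = sqrt s / sqrt D + sqrt s / sqrt (s - D)"
    by (simp add: \<delta>_def distrib_left)
  have nonneg: "0 \<le> sqrt s / sqrt D" "0 \<le> sqrt s / sqrt (s - D)" using D by auto
  show b0: "0 < b" using D by (simp add: b_def)
  have b: "b \<le> sqrt s / sqrt D"
    using D by (simp add: b_def real_sqrt_divide divide_right_mono)
  have "1 / b = sqrt D / sqrt (s - D)"
    using D by (simp add: b_def real_sqrt_divide)
  also have "\<dots> \<le> sqrt s / sqrt (s - D)"
    using D by (intro divide_right_mono) auto
  finally have b': "1 / b \<le> sqrt s / sqrt (s - D)" .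
  show "b \<le> sqrt s * \<delta>" "1 / b \<le> sqrt s * \<delta>"
    using b b' nonneg unfolding expand by linarith+
  have "1 \<le> sqrt s / sqrt D" using D by simp
  then show "1 \<le> sqrt s * \<delta>" using nonneg unfolding expand by linarith
  have "b\<^sup>2 = (s - D) / D" using D by (simp add: b_def)
  then have qb: "q * b\<^sup>2 = 1 - q" using D by (simp add: q_def field_simps)
  have "q * b ^ 3 = (1 - q) * b"
    unfolding qb[symmetric] by (simp add: power2_eq_square power3_eq_cube)
  also have "\<dots> \<le> b" using q b0 mult_right_mono[of "1 - q" 1 b] by simp
  finally have 1: "q * b ^ 3 \<le> b" .
  have "(1 - q) / b ^ 3 = q * (1 / b)"
    unfolding qb[symmetric] using b0 by (simp add: power2_eq_square power3_eq_cube)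
  also have "\<dots> \<le> 1 / b" using q b0 mult_right_mono[of q 1 "1 / b"] by simp
  finally have 2: "(1 - q) / b ^ 3 \<le> 1 / b" .
  show "q * b ^ 3 + (1 - q) / b ^ 3 \<le> sqrt s * \<delta>"
    using 1 2 b b' unfolding expand by linarith
qed

text \<open>
  Pointwise positivity of the success probabilities does not bound the logarithms uniformly. For large \<open>n\<close>
  the perturbations are at most \<open>1 / 2\<close> because they are of the order of the error rate; for each of the
  remaining sizes a positive margin comes from compactness of the parameter space.
\<close>

lemma channel_uniform_margin:
  fixes J :: "('p::finite, 'd::finite) couplings" and D :: "nat \<Rightarrow> real"
  defines "b \<equiv> bcoef CARD('p) D"
  assumes channel: "channel_well_defined J D lam"
    and pos: "\<And>n. n \<ge> 1 \<Longrightarrow> 0 < b n"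
    and small: "\<And>n \<alpha> u. n \<ge> 1 \<Longrightarrow> \<alpha> \<in> multi_indices n \<Longrightarrow> u \<in> params n \<Longrightarrow>
      \<bar>sqrt lam * zsig J n \<alpha> u\<bar> \<le> \<epsilon> n"
    and rate: "\<And>n. n \<ge> 1 \<Longrightarrow> b n * \<epsilon> n \<le> r n" "\<And>n. n \<ge> 1 \<Longrightarrow> \<epsilon> n / b n \<le> r n"
    and r: "(r \<longlongrightarrow> 0) sequentially"
  obtains \<kappa> where "0 < \<kappa>" "\<kappa> \<le> 1"
    "\<And>n \<alpha> u. n \<ge> 1 \<Longrightarrow> \<alpha> \<in> multi_indices n \<Longrightarrow> u \<in> params n \<Longrightarrow>
      \<kappa> \<le> 1 + b n * sqrt lam * zsig J n \<alpha> u \<and> \<kappa> \<le> 1 - sqrt lam * zsig J n \<alpha> u / b n"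
proof -
  define P where "P = (\<lambda>n \<kappa>. \<forall>\<alpha>\<in>multi_indices n. (\<forall>u\<in>params n. \<kappa> \<le> 1 + b n * sqrt lam * zsig J n \<alpha> u) \<and>
      (\<forall>u\<in>params n. \<kappa> \<le> 1 - sqrt lam * zsig J n \<alpha> u / b n))"
  have "eventually (\<lambda>n. r n < 1 / 2) sequentially"
    by (rule order_tendstoD(2)[OF r]) simp
  then obtain n1 where n1: "\<And>n. n \<ge> n1 \<Longrightarrow> r n < 1 / 2"
    by (auto simp: eventually_sequentially)
  have half: "\<bar>b n * (sqrt lam * zsig J n \<alpha> u)\<bar> \<le> 1 / 2" "\<bar>sqrt lam * zsig J n \<alpha> u / b n\<bar> \<le> 1 / 2"
    if "n \<ge> max 1 n1" "\<alpha> \<in> multi_indices n" "u \<in> params n" for n \<alpha> u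
  proof -
    have n: "n \<ge> 1" "n \<ge> n1" using that by auto
    have "\<bar>b n * (sqrt lam * zsig J n \<alpha> u)\<bar> \<le> b n * \<epsilon> n"
      using small[OF n(1) that(2,3)] pos[OF n(1)] by (simp only: abs_mult) (simp add: abs_mult)
    then show "\<bar>b n * (sqrt lam * zsig J n \<alpha> u)\<bar> \<le> 1 / 2"
      using rate(1)[OF n(1)] n1[OF n(2)] by linarith
    have "\<bar>sqrt lam * zsig J n \<alpha> u / b n\<bar> \<le> \<epsilon> n / b n"
      using divide_right_mono[OF small[OF n(1) that(2,3)], of "b n"] pos[OF n(1)] by (simp add: abs_divide)
    then show "\<bar>sqrt lam * zsig J n \<alpha> u / b n\<bar> \<le> 1 / 2"
      using rate(2)[OF n(1)] n1[OF n(2)] by linarith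
  qed
  have "\<forall>\<^sub>F \<kappa> in at_right 0. \<forall>n\<ge>1. P n \<kappa>"
  proof (rule eventually_for_all_sizes)
    fix n :: nat assume n: "n \<ge> 1"
    show "eventually (P n) (at_right 0)"
      unfolding P_def
    proof (rule eventually_ball_finite[OF finite_multi_indices], rule ballI, rule eventually_conj)
      fix \<alpha> :: "'p \<Rightarrow> nat" assume "\<alpha> \<in> multi_indices n"
      then have pos2: "0 < 1 + b n * sqrt lam * zsig J n \<alpha> u" "0 < 1 - sqrt lam * zsig J n \<alpha> u / b n"
        if "u \<in> params n" for u
        using channel n that unfolding channel_well_defined_def b_def by auto
      have b0: "b n \<noteq> 0" using pos[OF n] by simp
      show "\<forall>\<^sub>F \<kappa> in at_right 0. \<forall>u\<in>params n. \<kappa> \<le> 1 + b n * sqrt lam * zsig J n \<alpha> u"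
        by (intro eventually_le_on_compact compact_params pos2(1) continuous_on_add
            continuous_on_mult continuous_on_const continuous_on_zsig)
      show "\<forall>\<^sub>F \<kappa> in at_right 0. \<forall>u\<in>params n. \<kappa> \<le> 1 - sqrt lam * zsig J n \<alpha> u / b n"
        using b0
        by (intro eventually_le_on_compact compact_params pos2(2) continuous_on_diff
            continuous_on_divide continuous_on_mult continuous_on_const continuous_on_zsig) auto
    qed
  next
    show "\<forall>\<^sub>F \<kappa> in at_right 0. \<forall>n\<ge>max 1 n1. P n \<kappa>"
    proof (rule eventually_at_rightI[of 0 "1 / 2"])
      fix \<kappa> :: real assume \<kappa>: "\<kappa> \<in> {0<..<1 / 2}"
      show "\<forall>n\<ge>max 1 n1. P n \<kappa>"
        unfolding P_def
      proof (intro allI impI ballI conjI)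
        fix n and u :: "nat \<Rightarrow> real ^ 'd" and \<alpha> :: "'p \<Rightarrow> nat" assume *: "n \<ge> max 1 n1" "\<alpha> \<in> multi_indices n" "u \<in> params n"
        show "\<kappa> \<le> 1 + b n * sqrt lam * zsig J n \<alpha> u"
          using half(1)[OF *] \<kappa> unfolding mult.assoc greaterThanLessThan_iff by linarith
        show "\<kappa> \<le> 1 - sqrt lam * zsig J n \<alpha> u / b n"
          using half(2)[OF *] \<kappa> unfolding greaterThanLessThan_iff by linarith
      qed
    qed simp
  qed
  moreover have "\<forall>\<^sub>F \<kappa> in at_right 0. 0 < \<kappa> \<and> \<kappa> \<le> (1::real)"
    by (rule eventually_at_rightI[of 0 1]) auto
  ultimately have "\<forall>\<^sub>F \<kappa> in at_right 0. (0 < \<kappa> \<and> \<kappa> \<le> 1) \<and> (\<forall>n\<ge>1. P n \<kappa>)"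
    by eventually_elim blast
  then obtain \<kappa> where "0 < \<kappa>" "\<kappa> \<le> 1" "\<forall>n\<ge>1. P n \<kappa>"
    using eventually_happens'[OF trivial_limit_at_right_real] by blast
  then show thesis
    by (intro that[of \<kappa>]) (auto simp: P_def)
qed

section \<open>Universality of the free energy\<close>

theorem theorem11:
  fixes J :: "('p::finite, 'd::finite) couplings"
    and D :: "nat \<Rightarrow> real" and lam lam_star :: real
  assumes "CARD('p) \<ge> 2" and "lam > 0" and "lam_star > 0"
    and "\<And>n. n \<ge> 1 \<Longrightarrow> D n \<in> {0<..<edge_scale CARD('p) n}"
    and "(\<lambda>n. SUP \<alpha>\<in>multi_indices n. norm (J n \<alpha>)) \<in> O(\<lambda>_. 1)"
    and "filterlim D at_top sequentially"
    and "filterlim (\<lambda>n. edge_scale CARD('p) n - D n) at_top sequentially"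
    and "channel_well_defined J D lam" and "channel_well_defined J D lam_star"
  shows "\<exists>C. \<forall>n\<ge>1. \<forall>\<pi>. prior n \<pi> \<longrightarrow>
    (SUP \<theta>\<in>params n. ereal \<bar>bernoulli_free_energy J D lam lam_star n \<pi> \<theta> - gaussian_free_energy J lam lam_star n \<pi> \<theta>\<bar>)
      \<le> ereal (C * error_rate CARD('p) D n)"
proof -
  let ?s = "edge_scale CARD('p)" and ?\<delta> = "error_rate CARD('p) D"
  define b where "b = bcoef CARD('p) D"
  have D: "0 < D n" "D n < ?s n" if "n \<ge> 1" for n using assms(4)[OF that] by auto
  have b_eq: "b n = sqrt ((?s n - D n) / D n)" for n by (simp add: b_def bcoef_def)
  note scaling = sparse_scaling[OF D, folded b_eq error_rate_def]
  obtain K where K: "0 \<le> K" "\<And>n \<alpha>. n \<ge> 1 \<Longrightarrow> \<alpha> \<in> multi_indices n \<Longrightarrow> norm (J n \<alpha>) \<le> K"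
    using couplings_uniformly_bounded[OF assms(5)] by blast
  define K' where "K' = K * CARD('p \<Rightarrow> 'd)"
  \<comment> \<open>\<open>L / sqrt s\<close> bounds the signals of both channels, for \<open>lam\<close> and for \<open>lam_star\<close>.\<close>
  define L where "L = (sqrt lam + sqrt lam_star) * K'"
  define \<epsilon> where "\<epsilon> = (\<lambda>n. L / sqrt (?s n))"
  have K': "0 \<le> K'" using K by (simp add: K'_def)
  have L: "0 \<le> L" using K' assms by (simp add: L_def)
  have s1: "1 \<le> ?s n" if "n \<ge> 1" for n using that by (simp add: edge_scale_def)
  have small: "\<bar>sqrt lam * zsig J n \<alpha> u\<bar> \<le> \<epsilon> n \<and> \<bar>sqrt lam_star * zsig J n \<alpha> u\<bar> \<le> \<epsilon> n"
    if "n \<ge> 1" "\<alpha> \<in> multi_indices n" "u \<in> params n" for n \<alpha> u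
  proof -
    have z: "\<bar>zsig J n \<alpha> u\<bar> \<le> K' / sqrt (?s n)"
      unfolding K'_def using that K by (intro abs_zsig_le) auto
    have \<epsilon>_eq: "\<epsilon> n = (sqrt lam + sqrt lam_star) * (K' / sqrt (?s n))"
      by (simp add: \<epsilon>_def L_def)
    have "\<bar>c * zsig J n \<alpha> u\<bar> \<le> \<epsilon> n" if "0 \<le> c" "c \<le> sqrt lam + sqrt lam_star" for c
      unfolding \<epsilon>_eq abs_mult using that z by (intro mult_mono) auto
    then show ?thesis using assms by simp
  qed
  have \<epsilon>: "0 \<le> \<epsilon> n" "\<epsilon> n \<le> 1 + L" if "n \<ge> 1" for n
  proof -
    show "0 \<le> \<epsilon> n" using L s1[OF that] by (simp add: \<epsilon>_def)
    have "L / sqrt (?s n) \<le> L / 1" using L s1[OF that] by (intro divide_left_mono) auto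
    then show "\<epsilon> n \<le> 1 + L" by (simp add: \<epsilon>_def)
  qed
  have rate: "b n * \<epsilon> n \<le> L * ?\<delta> n" "\<epsilon> n / b n \<le> L * ?\<delta> n" if n: "n \<ge> 1" for n
  proof -
    have s0: "0 < sqrt (?s n)" using s1[OF n] by simp
    have "x * \<epsilon> n \<le> L * ?\<delta> n" if "x \<le> sqrt (?s n) * ?\<delta> n" for x
    proof -
      have "x * \<epsilon> n \<le> sqrt (?s n) * ?\<delta> n * \<epsilon> n"
        using that \<epsilon>[OF n] by (intro mult_right_mono)
      also have "\<dots> = L * ?\<delta> n" using s0 by (simp add: \<epsilon>_def)
      finally show ?thesis .
    qed
    from this[OF scaling(2)[OF n n]] this[OF scaling(3)[OF n n]]
    show "b n * \<epsilon> n \<le> L * ?\<delta> n" "\<epsilon> n / b n \<le> L * ?\<delta> n" by auto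
  qed
  have \<delta>0: "(?\<delta> \<longlongrightarrow> 0) sequentially"
    using assms(6,7) by (rule error_rate_tendsto_0)
  then have "Bseq ?\<delta>" by (intro convergent_imp_Bseq) (auto simp: convergent_def)
  then obtain \<Delta> where \<Delta>: "0 < \<Delta>" "\<And>n. \<bar>?\<delta> n\<bar> \<le> \<Delta>" by (auto simp: Bseq_def)
  have "((\<lambda>n. L * ?\<delta> n) \<longlongrightarrow> 0) sequentially"
    using tendsto_mult_right_zero[OF \<delta>0] by simp
  then obtain \<kappa> where \<kappa>: "0 < \<kappa>" "\<kappa> \<le> 1"
    "\<And>n \<alpha> u. n \<ge> 1 \<Longrightarrow> \<alpha> \<in> multi_indices n \<Longrightarrow> u \<in> params n \<Longrightarrow>
      \<kappa> \<le> 1 + b n * sqrt lam * zsig J n \<alpha> u \<and> \<kappa> \<le> 1 - sqrt lam * zsig J n \<alpha> u / b n"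
    using channel_uniform_margin[OF assms(8), where \<epsilon>=\<epsilon> and r="\<lambda>n. L * ?\<delta> n"]
      scaling(1) small rate unfolding b_def by blast
  define A where "A = (1 + L * \<Delta>) / (3 * \<kappa>) + 1 / 2"
  define C where "C = (A + 8000 * (1 + L) ^ 4) * L ^ 3"
  have A: "0 \<le> A" using L \<Delta> \<kappa> by (auto simp: A_def)
  have "\<bar>bernoulli_free_energy J D lam lam_star n \<pi> \<theta> - gaussian_free_energy J lam lam_star n \<pi> \<theta>\<bar>
      \<le> C * ?\<delta> n" if n: "n \<ge> 1" and \<pi>: "prior n \<pi>" and \<theta>: "\<theta> \<in> params n" for n \<pi> \<theta>
  proof -
    define q where "q = D n / ?s n"
    define \<tau> where "\<tau> = q * b n ^ 3 + (1 - q) / b n ^ 3"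
    have "L * ?\<delta> n \<le> L * \<Delta>" using \<Delta>(2)[of n] L by (intro mult_left_mono) auto
    then have B: "b n * \<epsilon> n \<le> L * \<Delta>" "\<epsilon> n / b n \<le> L * \<Delta>" using rate[OF n] by auto
    have "\<bar>bernoulli_free_energy J D lam lam_star n \<pi> \<theta> - gaussian_free_energy J lam lam_star n \<pi> \<theta>\<bar>
        \<le> ?s n * ((A * \<tau> + 8000 * (1 + L) ^ 4) * \<epsilon> n ^ 3)"
      unfolding A_def \<tau>_def q_def b_def
      by (rule free_energy_gap[OF n \<pi> \<theta> _ _ assms(4)[OF n] \<epsilon>[OF n] _ B[unfolded b_def]
            small[OF n] \<kappa>(1,2) \<kappa>(3)[OF n, unfolded b_def] assms(9)])
        (use assms L in auto)
    \<comment> \<open>The Gaussian error carries no factor \<open>\<tau>\<close>; it is absorbed with \<open>1 \<le> sqrt s * \<delta>\<close>.\<close>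
    also have "\<dots> \<le> ?s n * ((A * (sqrt (?s n) * ?\<delta> n) + 8000 * (1 + L) ^ 4 * (sqrt (?s n) * ?\<delta> n)) * \<epsilon> n ^ 3)"
    proof (intro mult_left_mono mult_right_mono add_mono)
      show "\<tau> \<le> sqrt (?s n) * ?\<delta> n"
        unfolding \<tau>_def q_def by (rule scaling(5)[OF n n])
      show "8000 * (1 + L) ^ 4 \<le> 8000 * (1 + L) ^ 4 * (sqrt (?s n) * ?\<delta> n)"
        using mult_left_mono[OF scaling(4)[OF n n], of "8000 * (1 + L) ^ 4"] L by simp
    qed (use A \<epsilon>[OF n] s1[OF n] in auto)
    also have "\<dots> = C * ?\<delta> n * (?s n * sqrt (?s n) / sqrt (?s n) ^ 3)"
      unfolding C_def \<epsilon>_def by (simp add: power_divide algebra_simps add_divide_distrib)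
    also have "?s n * sqrt (?s n) / sqrt (?s n) ^ 3 = 1"
      using s1[OF n] by (simp add: power3_eq_cube)
    finally show ?thesis by simp
  qed
  then show ?thesis
    by (intro exI[of _ C] allI impI SUP_least) simp
qed

end
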